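(* Let $\mathbb F$ be a field and let $\mathfrak q=(q_{ij})$ be a multiplicatively antisymmetric $n\times n$ matrix with entries in $\mathbb F^\ast$. If the quantum torus $\widehat{\mathcal O}_{\mathfrak q}$ corresponding to the quantum affine space $\mathcal O_{\mathfrak q}$ has dimension one, then $\mathcal O_{\mathfrak q}$ has a trivial automorphism group, that is, $\mathrm{Aut}_{\mathbb F}(\mathcal O_{\mathfrak q})=(\mathbb F^\ast)^n$.
   Context: Multiplicatively antisymmetric means $q_{ii}=1$ and $q_{ji}=q_{ij}^{-1}$. The quantum affine space $\mathcal O_{\mathfrak q}$ (of rank $n$) is the quotient of the free associative $\mathbb F$-algebra on $X_1,\dots,X_n$ by the ideal generated by $X_iX_j-q_{ij}X_jX_i$, $1\le i<j\le n$. The corresponding quantum torus $\widehat{\mathcal O}_{\mathfrak q}$ is the $\mathbb F$-algebra generated by $X_1,\dots,X_n$ together with their inverses subject to the same relations (the localization of $\mathcal O_{\mathfrak q}$ at the multiplicative set generated by the $X_i$). The dimension of $\widehat{\mathcal O}_{\mathfrak q}$ means its Krull dimension, which coincides with its global dimension. It is known (Brookes) that this dimension equals the supremum of the ranks of the subgroups $B\le\mathbb Z^n$ for which the monomials $\mathbf X^\gamma=X_1^{\gamma_1}\cdots X_n^{\gamma_n}$, $\gamma\in B$, commute pairwise; so dimension one means that no two monomials $\mathbf X^\gamma,\mathbf X^{\gamma'}$ with $\gamma,\gamma'\in\mathbb Z^n$ linearly independent commute. $\mathrm{Aut}_{\mathbb F}(\mathcal O_{\mathfrak q})$ is the group of $\mathbb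 F$-algebra automorphisms of $\mathcal O_{\mathfrak q}$, and $(\mathbb F^\ast)^n$ is identified with the subgroup of automorphisms $X_i\mapsto t_iX_i$, $t_i\in\mathbb F^\ast$.
   Formalization: The rank n is assumed to be at least 2: for n = 1 the quantum torus F[X, X^{-1}] has dimension one, but O_q = F[X] has the automorphism X -> X + 1, which is not in F^*, so the statement fails there; for n = 0 the dimension is 0. *)

theory Defs
  imports "HOL-Algebra.QuotRing" "HOL-Algebra.Bij" "HOL-Library.Poly_Mapping"
    "HOL-Library.Cardinality"
begin

section \<open>Free associative algebras and presentations\<close>

text \<open>Lists form the free monoid, written additively because the convolution product of
  finitely supported functions in \<^theory>\<open>HOL-Library.Poly_Mapping\<close> is indexed by an additive
  monoid (which need not be commutative). The type \<open>'g list \<Rightarrow>\<^sub>0 'f\<close> is then the free associative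
  unital \<open>'f\<close>-algebra on the generators \<open>'g\<close>.\<close>

instantiation list :: (type) monoid_add
begin
definition zero_list :: "'a list" where "zero_list = []"
definition plus_list :: "'a list \<Rightarrow> 'a list \<Rightarrow> 'a list" where "plus_list = append"
instance by standard (simp_all add: zero_list_def plus_list_def)
end

definition free_algebra :: "('g list \<Rightarrow>\<^sub>0 'f::field) ring" where
  "free_algebra = \<lparr>carrier = UNIV, mult = (*), one = 1, zero = 0, add = (+)\<rparr>"

definition const :: "'f::field \<Rightarrow> ('g list \<Rightarrow>\<^sub>0 'f)" where
  "const c = Poly_Mapping.single [] c"

definition gen :: "'g \<Rightarrow> ('g list \<Rightarrow>\<^sub>0 'f::field)" where
  "gen x = Poly_Mapping.single [x] 1"

definition presented_algebra :: "('g list \<Rightarrow>\<^sub>0 'f::field) set \<Rightarrow> ('g list \<Rightarrow>\<^sub>0 'f) set ring" where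
  "presented_algebra rels = free_algebra Quot (Idl\<^bsub>free_algebra\<^esub> rels)"

definition residue_class ::
    "('g list \<Rightarrow>\<^sub>0 'f::field) set \<Rightarrow> ('g list \<Rightarrow>\<^sub>0 'f) \<Rightarrow> ('g list \<Rightarrow>\<^sub>0 'f) set" where
  "residue_class rels a = (Idl\<^bsub>free_algebra\<^esub> rels) +>\<^bsub>free_algebra\<^esub> a"

lemma ring_free_algebra: "ring (free_algebra :: ('g list \<Rightarrow>\<^sub>0 'f::field) ring)"
proof (rule ringI)
  show "abelian_group (free_algebra :: ('g list \<Rightarrow>\<^sub>0 'f) ring)"
  proof (rule abelian_groupI)
    fix x :: "'g list \<Rightarrow>\<^sub>0 'f"
    show "\<exists>y\<in>carrier free_algebra. y \<oplus>\<^bsub>free_algebra\<^esub> x = \<zero>\<^bsub>free_algebra\<^esub>"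
      by (rule bexI[of _ "- x"]) (simp_all add: free_algebra_def)
  qed (simp_all add: free_algebra_def add_ac)
  show "monoid (free_algebra :: ('g list \<Rightarrow>\<^sub>0 'f) ring)"
    by (rule monoidI) (simp_all add: free_algebra_def mult.assoc)
qed (simp_all add: free_algebra_def algebra_simps)

lemma ideal_relations:
  "ideal (Idl\<^bsub>free_algebra\<^esub> rels) (free_algebra :: ('g list \<Rightarrow>\<^sub>0 'f::field) ring)"
  by (rule ring.genideal_ideal[OF ring_free_algebra]) (simp add: free_algebra_def)

lemma ring_presented_algebra: "ring (presented_algebra rels)"
  unfolding presented_algebra_def by (rule ideal.quotient_is_ring[OF ideal_relations])


section \<open>Quantum affine spaces and quantum tori\<close>

definition mult_antisymmetric :: "('n \<Rightarrow> 'n \<Rightarrow> 'f::field) \<Rightarrow> bool" where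
  "mult_antisymmetric q \<longleftrightarrow>
     (\<forall>i j. q i j \<noteq> 0) \<and> (\<forall>i. q i i = 1) \<and> (\<forall>i j. q j i = inverse (q i j))"

definition affine_relations ::
    "('n::{finite,linorder} \<Rightarrow> 'n \<Rightarrow> 'f::field) \<Rightarrow> ('n list \<Rightarrow>\<^sub>0 'f) set" where
  "affine_relations q = {gen i * gen j - const (q i j) * gen j * gen i | i j. i < j}"

definition quantum_affine_space ::
    "('n::{finite,linorder} \<Rightarrow> 'n \<Rightarrow> 'f::field) \<Rightarrow> ('n list \<Rightarrow>\<^sub>0 'f) set ring" where
  "quantum_affine_space q = presented_algebra (affine_relations q)"

definition affine_scalar ::
    "('n::{finite,linorder} \<Rightarrow> 'n \<Rightarrow> 'f::field) \<Rightarrow> 'f \<Rightarrow> ('n list \<Rightarrow>\<^sub>0 'f) set" where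
  "affine_scalar q c = residue_class (affine_relations q) (const c)"

definition affine_gen ::
    "('n::{finite,linorder} \<Rightarrow> 'n \<Rightarrow> 'f::field) \<Rightarrow> 'n \<Rightarrow> ('n list \<Rightarrow>\<^sub>0 'f) set" where
  "affine_gen q i = residue_class (affine_relations q) (gen i)"

text \<open>For the torus, the letter \<open>Inl i\<close> stands for \<open>X\<^sub>i\<close> and \<open>Inr i\<close> for its inverse.\<close>

definition torus_relations ::
    "('n::{finite,linorder} \<Rightarrow> 'n \<Rightarrow> 'f::field) \<Rightarrow> (('n + 'n) list \<Rightarrow>\<^sub>0 'f) set" where
  "torus_relations q =
     {gen (Inl i) * gen (Inl j) - const (q i j) * gen (Inl j) * gen (Inl i) | i j. i < j}
     \<union> {gen (Inl i) * gen (Inr i) - 1 | i. True}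
     \<union> {gen (Inr i) * gen (Inl i) - 1 | i. True}"

definition quantum_torus ::
    "('n::{finite,linorder} \<Rightarrow> 'n \<Rightarrow> 'f::field) \<Rightarrow> (('n + 'n) list \<Rightarrow>\<^sub>0 'f) set ring" where
  "quantum_torus q = presented_algebra (torus_relations q)"


section \<open>Krull dimension\<close>

text \<open>\<open>deviation_less k A\<close> says that the deviation (in the sense of Gabriel and Rentschler) of the
  poset \<open>A\<close> is less than \<open>k\<close>. A trivial poset has deviation minus infinity, which is the only value
  less than \<open>0\<close>; the deviation is less than \<open>k + 1\<close> iff in every descending chain
  \<open>c 0 \<ge> c 1 \<ge> \<dots>\<close> of \<open>A\<close> all but finitely many of the factors \<open>{x \<in> A. c (m + 1) \<le> x \<le> c m}\<close> have
  deviation less than \<open>k\<close>. In particular, \<open>deviation_less 1 A\<close> is the descending chain condition.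
  A poset with no deviation, or with an infinite ordinal as deviation, satisfies
  \<open>deviation_less k\<close> for no \<open>k\<close>.\<close>

primrec deviation_less :: "nat \<Rightarrow> 'a::order set \<Rightarrow> bool" where
  "deviation_less 0 A \<longleftrightarrow> (\<forall>a\<in>A. \<forall>b\<in>A. \<not> a < b)"
| "deviation_less (Suc k) A \<longleftrightarrow>
     (\<forall>c :: nat \<Rightarrow> 'a. range c \<subseteq> A \<and> antimono c \<longrightarrow>
        (\<exists>N. \<forall>m\<ge>N. deviation_less k {x \<in> A. c (Suc m) \<le> x \<and> x \<le> c m}))"

definition right_ideals :: "('a, 'b) ring_scheme \<Rightarrow> 'a set set" where
  "right_ideals R =
     {I. additive_subgroup I R \<and> (\<forall>a\<in>I. \<forall>x\<in>carrier R. a \<otimes>\<^bsub>R\<^esub> x \<in> I)}"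

text \<open>The Krull dimension of the right regular module. For quantum tori the left-handed version
  gives the same value.\<close>

definition has_krull_dim :: "('a, 'b) ring_scheme \<Rightarrow> nat \<Rightarrow> bool" where
  "has_krull_dim R d \<longleftrightarrow>
     deviation_less (Suc d) (right_ideals R) \<and> \<not> deviation_less d (right_ideals R)"


section \<open>Automorphism groups\<close>

text \<open>The algebra structure on \<open>R\<close> is given by the map \<open>\<iota>\<close> from the scalars into \<open>R\<close>.
  As in \<^theory>\<open>HOL-Algebra.Bij\<close>, automorphisms are extensional, so that they are
  determined by their values on the carrier.\<close>

definition algebra_auts :: "('f \<Rightarrow> 'a) \<Rightarrow> ('a, 'b) ring_scheme \<Rightarrow> ('a \<Rightarrow> 'a) set" where
  "algebra_auts \<iota> R =
     {\<phi> \<in> ring_hom R R \<inter> Bij (carrier R).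
        \<forall>c. \<forall>a\<in>carrier R. \<phi> (\<iota> c \<otimes>\<^bsub>R\<^esub> a) = \<iota> c \<otimes>\<^bsub>R\<^esub> \<phi> a}"

definition aut_group ::
    "('n::{finite,linorder} \<Rightarrow> 'n \<Rightarrow> 'f::field) \<Rightarrow>
       (('n list \<Rightarrow>\<^sub>0 'f) set \<Rightarrow> ('n list \<Rightarrow>\<^sub>0 'f) set) monoid" where
  "aut_group q =
     BijGroup (carrier (quantum_affine_space q))
       \<lparr>carrier := algebra_auts (affine_scalar q) (quantum_affine_space q)\<rparr>"

definition scaling_group :: "('n \<Rightarrow> 'f::field) monoid" where
  "scaling_group = \<lparr>carrier = {t. \<forall>i. t i \<noteq> 0}, mult = (\<lambda>s t i. s i * t i), one = (\<lambda>_. 1)\<rparr>"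

end

theory Submission
  imports Defs "HOL-Library.Multiset_Order" "HOL-Computational_Algebra.Formal_Power_Series"
begin

text \<open>
  Ordered monomials form a basis of the quantum affine space, and in this basis the product of two
  monomials is, up to a nonzero scalar, the monomial with the sum of the exponents
  (\<open>of_normal_form_hom\<close>, \<open>bij_betw_of_normal_form\<close>). The theorem thus becomes a statement about twisted
  polynomials, in which the commutation factor of \<open>X\<^sup>a\<close> and \<open>X\<^sup>b\<close> is a bicharacter \<open>\<lambda>(a, b)\<close>.

  The dimension hypothesis is used in the following form: \<open>\<lambda>(a, b) = 1\<close> only if the integer vectors \<open>a\<close> and
  \<open>b\<close> are linearly dependent (\<open>krull_dim_one_imp_nondegenerate\<close>). For if \<open>u\<close> and \<open>v\<close> are commuting
  monomials of the quantum torus \<open>T\<close> with independent exponents, then the factors of the chain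
  \<open>(1 - u)\<^sup>m T\<close> are isomorphic to \<open>T / (1 - u) T\<close>, and the images of \<open>(1 - v)\<^sup>k T\<close> descend strictly
  in this module, so the deviation of the poset of right ideals is at least two. Strictness is seen after projecting
  \<open>T\<close> onto the commutative ring of Laurent polynomials in \<open>u\<close> and \<open>v\<close>, embedded in a ring of power
  series in \<open>1 - u\<close> and \<open>1 - v\<close>.

  An automorphism preserves normal elements, such as the variables. Let \<open>w\<close> be normal with
  \<open>w X\<^sub>j = a w\<close>. Comparing largest and smallest exponents shows \<open>a = c X\<^sub>j\<close>, and then every
  monomial \<open>X\<^sup>A\<close> of \<open>w\<close> satisfies \<open>\<lambda>(A, e\<^sub>j) = c\<close>. Therefore the difference of two
  exponents of \<open>w\<close> lies in the radical of \<open>\<lambda>\<close>, which is zero as there are at least two variables.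
  Normal elements are thus scalar multiples of monomials (\<open>normal_element_imp_monomial\<close>). As the
  same applies to the inverse automorphism, the variables are permuted up to scalars
  (\<open>twisted_aut_permutes_vars\<close>).

  The permutation \<open>\<sigma>\<close> preserves \<open>q\<close> and fixes the vector \<open>s\<close> with all entries \<open>1\<close>. So
  \<open>\<lambda>(s, e\<^sub>i) = \<lambda>(s, e\<^sub>\<sigma>\<^sub>i)\<close>, that is, \<open>\<lambda>(s, e\<^sub>i - e\<^sub>\<sigma>\<^sub>i) = 1\<close>. Since \<open>s\<close> and a nonzero
  \<open>e\<^sub>i - e\<^sub>\<sigma>\<^sub>i\<close> are independent, \<open>\<sigma>\<close> is the identity (\<open>symmetry_trivial\<close>), and the automorphism only
  rescales the variables.
\<close>

section \<open>Additive maps on finitely supported functions\<close>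

text \<open>The scalars enter through the second argument of \<open>g\<close>, so that one construction serves
targets of every kind: iterated power series with scalars embedded as constants, and finitely
supported functions on another index type.\<close>

definition lin_ext :: "('k \<Rightarrow> 'c::zero \<Rightarrow> 'v::comm_monoid_add) \<Rightarrow> ('k \<Rightarrow>\<^sub>0 'c) \<Rightarrow> 'v" where
  "lin_ext g x = (\<Sum>k\<in>Poly_Mapping.keys x. g k (Poly_Mapping.lookup x k))"

lemma lin_ext_zero [simp]: "lin_ext g 0 = 0"
  by (simp add: lin_ext_def)

lemma lin_ext_single:
  assumes "\<And>k. g k 0 = 0"
  shows "lin_ext g (Poly_Mapping.single k c) = g k c"
  using assms by (simp add: lin_ext_def)

lemma lin_ext_add:
  assumes "\<And>k. g k 0 = 0" "\<And>k a b. g k (a + b) = g k a + g k b"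
  shows "lin_ext g (x + y) = lin_ext g x + lin_ext g y"
  unfolding lin_ext_def by (rule setsum_keys_plus_distrib) (use assms in auto)

text \<open>Every finitely supported function is a sum of functions supported at one point; hence identities
between additive maps need to be checked at such functions only.\<close>

lemma poly_mapping_add_induct [case_names single add]:
  fixes x :: "'k \<Rightarrow>\<^sub>0 'c::monoid_add"
  assumes single: "\<And>k c. P (Poly_Mapping.single k c)"
    and add: "\<And>x y. P x \<Longrightarrow> P y \<Longrightarrow> P (x + y)"
  shows "P x"
proof (induction x rule: update_induct)
  case const
  show ?case using single[of undefined 0] by simp
next
  case (update f a b)
  have "Poly_Mapping.update a b f = f + Poly_Mapping.single a b"
    using update by (intro poly_mapping_eqI)
      (auto simp: lookup_update lookup_add lookup_single in_keys_iff)
  then show ?case using update add single by simp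
qed

lemma additive_eqI:
  fixes f g :: "('k \<Rightarrow>\<^sub>0 'c::monoid_add) \<Rightarrow> 'v::monoid_add"
  assumes "\<And>x y. f (x + y) = f x + f y" "\<And>x y. g (x + y) = g x + g y"
    and "\<And>k c. f (Poly_Mapping.single k c) = g (Poly_Mapping.single k c)"
  shows "f x = g x"
  by (induction x rule: poly_mapping_add_induct) (simp_all add: assms)

text \<open>Words span the free algebra, so the arbitrary factors may be replaced by scaled words, on which
additive maps are given explicitly.\<close>

lemma vanish_on_sandwich:
  fixes P :: "('g list \<Rightarrow>\<^sub>0 'f::field) \<Rightarrow> 'v::monoid_add"
  assumes P: "\<And>x y. P (x + y) = P x + P y"
    and words: "\<And>v c w d. P (Poly_Mapping.single v c * r * Poly_Mapping.single w d) = 0"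
  shows "P (a * r * b) = 0"
proof (induction a rule: poly_mapping_add_induct)
  case (single v c)
  show ?case
    by (induction b rule: poly_mapping_add_induct) (simp_all add: words P distrib_left)
qed (simp add: P distrib_right)

section \<open>Quotients of free algebras\<close>

lemma word_mult_single:
  "Poly_Mapping.single v c * Poly_Mapping.single w d
     = Poly_Mapping.single (v @ w) (c * d :: 'f::field)"
  by (simp add: mult_single plus_list_def)

lemma one_eq_single_Nil: "(1 :: 'g list \<Rightarrow>\<^sub>0 'f::field) = Poly_Mapping.single [] 1"
  by (metis single_one zero_list_def)

lemma free_algebra_simps [simp]:
  "carrier free_algebra = UNIV"
  "x \<otimes>\<^bsub>free_algebra\<^esub> y = x * y"
  "x \<oplus>\<^bsub>free_algebra\<^esub> y = x + y"
  "\<one>\<^bsub>free_algebra\<^esub> = 1"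
  "\<zero>\<^bsub>free_algebra\<^esub> = 0"
  by (simp_all add: free_algebra_def)

lemma a_inv_free_algebra [simp]: "\<ominus>\<^bsub>free_algebra\<^esub> x = - x"
proof -
  interpret ring "free_algebra :: ('a list \<Rightarrow>\<^sub>0 'b) ring" by (rule ring_free_algebra)
  show ?thesis using minus_equality[of "- x" x] by simp
qed

lemma a_minus_free_algebra [simp]: "x \<ominus>\<^bsub>free_algebra\<^esub> y = x - y"
  by (simp add: a_minus_def)

lemma additive_subgroup_free_algebraI:
  fixes J :: "('g list \<Rightarrow>\<^sub>0 'f::field) set"
  assumes "0 \<in> J" "\<And>x y. x \<in> J \<Longrightarrow> y \<in> J \<Longrightarrow> x + y \<in> J" "\<And>x. x \<in> J \<Longrightarrow> - x \<in> J"
  shows "additive_subgroup J free_algebra"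
proof -
  interpret ring "free_algebra :: ('g list \<Rightarrow>\<^sub>0 'f) ring" by (rule ring_free_algebra)
  have "\<And>x. inv\<^bsub>add_monoid free_algebra\<^esub> x = - (x :: 'g list \<Rightarrow>\<^sub>0 'f)"
    using a_inv_free_algebra by (simp add: a_inv_def)
  then show ?thesis using assms
    by (intro additive_subgroup.intro add.subgroupI) auto
qed

lemma genideal_free_algebra_subset:
  fixes J :: "('g list \<Rightarrow>\<^sub>0 'f::field) set"
  assumes "rels \<subseteq> J" "0 \<in> J" "\<And>x y. x \<in> J \<Longrightarrow> y \<in> J \<Longrightarrow> x + y \<in> J"
    "\<And>a x. x \<in> J \<Longrightarrow> a * x \<in> J" "\<And>a x. x \<in> J \<Longrightarrow> x * a \<in> J"
  shows "Idl\<^bsub>free_algebra\<^esub> rels \<subseteq> J"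
proof -
  have "- x \<in> J" if "x \<in> J" for x
    using assms(4)[OF that, of "-1"] by simp
  then have "additive_subgroup J free_algebra"
    using assms by (intro additive_subgroup_free_algebraI)
  then have "ideal J free_algebra"
    using assms(4,5)
    by (intro idealI ring_free_algebra) (auto simp: additive_subgroup_def)
  then show ?thesis
    using assms(1) by (intro ring.genideal_minimal[OF ring_free_algebra])
qed

lemma residue_class_eq_iff:
  "residue_class rels x = residue_class rels y \<longleftrightarrow> x - y \<in> Idl\<^bsub>free_algebra\<^esub> rels"
  using ring.quotient_eq_iff_same_a_r_cos[OF ring_free_algebra ideal_relations, of x y rels]
  by (simp add: residue_class_def)

lemma residue_class_relation:
  assumes "x - y \<in> rels"
  shows "residue_class rels x = residue_class rels y"
  using assms ring.genideal_self[OF ring_free_algebra, of rels]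
  by (auto simp: residue_class_eq_iff)

lemma carrier_presented_algebra:
  "carrier (presented_algebra rels) = range (residue_class rels)"
  by (auto simp: presented_algebra_def residue_class_def FactRing_def A_RCOSETS_def')

lemma residue_class_hom:
  "residue_class rels \<in> ring_hom free_algebra (presented_algebra rels)"
  using ideal.rcos_ring_hom[OF ideal_relations, of rels]
  by (simp add: presented_algebra_def residue_class_def [abs_def])

lemma residue_class_mult:
  "residue_class rels x \<otimes>\<^bsub>presented_algebra rels\<^esub> residue_class rels y = residue_class rels (x * y)"
  using ring_hom_mult[OF residue_class_hom, of x y rels] by simp

lemma residue_class_add:
  "residue_class rels x \<oplus>\<^bsub>presented_algebra rels\<^esub> residue_class rels y = residue_class rels (x + y)"
  using ring_hom_add[OF residue_class_hom, of x y rels] by simp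

lemma residue_class_one: "\<one>\<^bsub>presented_algebra rels\<^esub> = residue_class rels 1"
  using ring_hom_one[OF residue_class_hom, of rels] by simp

text \<open>This lets right ideals of a presented algebra be written down in the free algebra, where
calculations take place in an ordinary ring type.\<close>

lemma right_ideal_image:
  fixes J :: "('g list \<Rightarrow>\<^sub>0 'f::field) set"
  assumes "0 \<in> J" "\<And>x y. x \<in> J \<Longrightarrow> y \<in> J \<Longrightarrow> x + y \<in> J" "\<And>a x. x \<in> J \<Longrightarrow> x * a \<in> J"
  shows "residue_class rels ` J \<in> right_ideals (presented_algebra rels)"
proof -
  have "- x \<in> J" if "x \<in> J" for x
    using assms(3)[OF that, of "-1"] by simp
  then have sub: "additive_subgroup J free_algebra"
    using assms by (intro additive_subgroup_free_algebraI)
  interpret h: ring_hom_ring free_algebra "presented_algebra rels" "residue_class rels"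
    by (intro ring_hom_ringI2 ring_free_algebra ring_presented_algebra residue_class_hom)
  have "additive_subgroup (residue_class rels ` J) (presented_algebra rels)"
    using h.img_is_add_subgroup[of J] sub by (simp add: additive_subgroup_def)
  then show ?thesis
    using assms(3) by (auto simp: right_ideals_def carrier_presented_algebra residue_class_mult)
qed

section \<open>Bicharacters\<close>

text \<open>With \<open>r = q\<close> this is the commutation factor of two Laurent monomials of the quantum torus:
\<open>X\<^sup>a X\<^sup>b = bichar q a b X\<^sup>b X\<^sup>a\<close>.\<close>

definition bichar :: "('n::finite \<Rightarrow> 'n \<Rightarrow> 'f::field) \<Rightarrow> ('n \<Rightarrow> int) \<Rightarrow> ('n \<Rightarrow> int) \<Rightarrow> 'f" where
  "bichar r a b = (\<Prod>i\<in>UNIV. \<Prod>j\<in>UNIV. r i j powi (a i * b j))"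

definition unit_vec :: "'n \<Rightarrow> 'n \<Rightarrow> int" where
  "unit_vec i = (\<lambda>k. if k = i then 1 else 0)"

text \<open>The bicharacter of \<open>lower q\<close> is the scalar that appears when \<open>X\<^sup>a X\<^sup>b\<close> is rewritten as a multiple
of the ordered monomial \<open>X\<^sup>a\<^sup>+\<^sup>b\<close>: a letter \<open>X\<^sub>i\<close> of the first factor has to move past those
letters \<open>X\<^sub>j\<close> of the second one that have \<open>j < i\<close>.\<close>

definition lower :: "('n::linorder \<Rightarrow> 'n \<Rightarrow> 'f::field) \<Rightarrow> 'n \<Rightarrow> 'n \<Rightarrow> 'f" where
  "lower q i j = (if j < i then q i j else 1)"

lemma bichar_nonzero:
  assumes "\<And>i j. r i j \<noteq> 0"
  shows "bichar r a b \<noteq> 0"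
  using assms by (simp add: bichar_def)

lemma bichar_add_left:
  assumes "\<And>i j. r i j \<noteq> 0"
  shows "bichar r (\<lambda>i. a i + b i) c = bichar r a c * bichar r b c"
  by (simp add: bichar_def distrib_right power_int_add assms prod.distrib)

lemma bichar_add_right:
  assumes "\<And>i j. r i j \<noteq> 0"
  shows "bichar r c (\<lambda>i. a i + b i) = bichar r c a * bichar r c b"
  by (simp add: bichar_def distrib_left power_int_add assms prod.distrib)

lemma power_int_prod: "(\<Prod>i\<in>A. f i) powi m = (\<Prod>i\<in>A. (f i :: 'f::field) powi m)"
  by (induction A rule: infinite_finite_induct) (simp_all add: power_int_mult_distrib)

lemma bichar_scale_left: "bichar r (\<lambda>i. m * a i) b = bichar r a b powi m"
proof -
  have "m * a i * b j = a i * b j * m" for i j by simp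
  then show ?thesis by (simp only: bichar_def power_int_prod power_int_mult)
qed

lemma bichar_scale_right: "bichar r a (\<lambda>i. m * b i) = bichar r a b powi m"
proof -
  have "a i * (m * b j) = a i * b j * m" for i j by simp
  then show ?thesis by (simp only: bichar_def power_int_prod power_int_mult)
qed

lemma bichar_zero_left [simp]: "bichar r (\<lambda>_. 0) b = 1"
  and bichar_zero_right [simp]: "bichar r a (\<lambda>_. 0) = 1"
  by (simp_all add: bichar_def)

lemma bichar_unit_right: "bichar r a (unit_vec j) = (\<Prod>i\<in>UNIV. r i j powi a i)"
proof -
  have "(\<Prod>k\<in>UNIV. r i k powi (a i * unit_vec j k)) = (\<Prod>k\<in>{j}. r i k powi (a i * unit_vec j k))" for i
    by (rule prod.mono_neutral_right) (auto simp: unit_vec_def)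
  then show ?thesis by (simp add: bichar_def unit_vec_def)
qed

lemma bichar_unit_unit: "bichar r (unit_vec i) (unit_vec j) = r i j"
proof -
  have "(\<Prod>k\<in>UNIV. r k j powi unit_vec i k) = (\<Prod>k\<in>{i}. r k j powi unit_vec i k)"
    by (rule prod.mono_neutral_right) (auto simp: unit_vec_def)
  then show ?thesis by (simp only: bichar_unit_right) (simp add: unit_vec_def)
qed

text \<open>The defining equations of antisymmetry rewrite \<open>q j i\<close> and \<open>q i j\<close> into each other without end;
these consequences are safe as rewrite rules.\<close>

lemma mult_antisymmetricD:
  assumes "mult_antisymmetric q"
  shows "q i j \<noteq> 0" "q i i = 1" "q i j * q j i = 1"
  using assms unfolding mult_antisymmetric_def by (blast, blast, metis right_inverse)

lemma lower_nonzero: "mult_antisymmetric q \<Longrightarrow> lower q i j \<noteq> 0"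
  by (simp add: lower_def mult_antisymmetricD)

text \<open>Entrywise, \<open>lower q i j = q i j * lower q j i\<close>; so the commutation factor is the
quotient of the two straightening factors.\<close>

lemma bichar_lower_commute:
  assumes "mult_antisymmetric q"
  shows "bichar (lower q) a b = bichar q a b * bichar (lower q) b a"
proof -
  have *: "lower q i j = q i j * lower q j i" for i j
    using mult_antisymmetricD[OF assms] by (cases i j rule: linorder_cases) (auto simp: lower_def)
  have "bichar (lower q) a b = (\<Prod>i\<in>UNIV. \<Prod>j\<in>UNIV. (q i j * lower q j i) powi (a i * b j))"
    unfolding bichar_def by (simp only: * [symmetric])
  also have "\<dots>
      = (\<Prod>i\<in>UNIV. \<Prod>j\<in>UNIV. q i j powi (a i * b j)) * (\<Prod>i\<in>UNIV. \<Prod>j\<in>UNIV. lower q j i powi (a i * b j))"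
    by (simp add: power_int_mult_distrib prod.distrib)
  also have "(\<Prod>i\<in>UNIV. \<Prod>j\<in>UNIV. lower q j i powi (a i * b j)) = bichar (lower q) b a"
    unfolding bichar_def by (subst prod.swap) (simp add: mult.commute)
  finally show ?thesis by (simp add: bichar_def)
qed

text \<open>This is Brookes' criterion for dimension one: two Laurent monomials commute only if
their exponents are linearly dependent.\<close>

definition nondegenerate :: "('n::finite \<Rightarrow> 'n \<Rightarrow> 'f::field) \<Rightarrow> bool" where
  "nondegenerate q \<longleftrightarrow>
     (\<forall>a b. bichar q a b = 1 \<longrightarrow> (\<exists>x y. (x \<noteq> 0 \<or> y \<noteq> 0) \<and> (\<forall>i. x * a i + y * b i = 0)))"

section \<open>Straightening words\<close>

text \<open>The letters carry weights in the lattice of exponents, so that the same straightening factors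
serve the affine space, whose letter \<open>i\<close> has weight \<open>unit_vec i\<close>, and the torus, where a second
copy of the letters has the opposite weights.\<close>

primrec weight :: "('g \<Rightarrow> 'n \<Rightarrow> int) \<Rightarrow> 'g list \<Rightarrow> 'n \<Rightarrow> int" where
  "weight \<epsilon> [] = (\<lambda>_. 0)"
| "weight \<epsilon> (l # w) = (\<lambda>i. \<epsilon> l i + weight \<epsilon> w i)"

text \<open>If \<open>r = lower q\<close>, this is the scalar by which a word differs from the ordered monomial of the same
weight.\<close>

primrec word_coeff ::
    "('n::finite \<Rightarrow> 'n \<Rightarrow> 'f::field) \<Rightarrow> ('g \<Rightarrow> 'n \<Rightarrow> int) \<Rightarrow> 'g list \<Rightarrow> 'f" where
  "word_coeff r \<epsilon> [] = 1"
| "word_coeff r \<epsilon> (l # w) = bichar r (\<epsilon> l) (weight \<epsilon> w) * word_coeff r \<epsilon> w"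

lemma weight_append: "weight \<epsilon> (v @ w) = (\<lambda>i. weight \<epsilon> v i + weight \<epsilon> w i)"
  by (induction v) (simp_all add: add.assoc)

lemma word_coeff_nonzero:
  assumes "\<And>i j. r i j \<noteq> 0"
  shows "word_coeff r \<epsilon> w \<noteq> 0"
  by (induction w) (simp_all add: bichar_nonzero assms)

lemma word_coeff_append:
  assumes "\<And>i j. r i j \<noteq> 0"
  shows "word_coeff r \<epsilon> (v @ w)
    = word_coeff r \<epsilon> v * word_coeff r \<epsilon> w * bichar r (weight \<epsilon> v) (weight \<epsilon> w)"
  by (induction v)
    (simp_all add: weight_append bichar_add_left bichar_add_right assms)

text \<open>Consequently a relation between two words of equal weight that is consistent with the
straightening factors stays consistent inside every longer word.\<close>

lemma word_coeff_context:
  assumes "\<And>i j. r i j \<noteq> 0" "weight \<epsilon> m = weight \<epsilon> m'" "word_coeff r \<epsilon> m = c * word_coeff r \<epsilon> m'"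
  shows "word_coeff r \<epsilon> (v @ m @ w) = c * word_coeff r \<epsilon> (v @ m' @ w)"
  using assms(2,3) by (simp add: word_coeff_append assms(1) weight_append)

section \<open>Commuting monomials and the Krull dimension\<close>

text \<open>The deviation is at least two if some descending chain has, between any two neighbours, another
strictly descending chain, because then no factor of the outer chain satisfies the descending
chain condition.\<close>

lemma not_deviation_less_2_if_chains:
  fixes I :: "nat \<Rightarrow> 'a set" and L :: "nat \<Rightarrow> nat \<Rightarrow> 'a set"
  assumes I: "\<And>m. I m \<in> A" "\<And>m. I (Suc m) \<subseteq> I m"
    and L: "\<And>m k. L m k \<in> A" "\<And>m k. L m (Suc k) \<subset> L m k"
    and between: "\<And>m k. I (Suc m) \<subseteq> L m k" "\<And>m k. L m k \<subseteq> I m"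
  shows "\<not> deviation_less 2 A"
proof
  assume *: "deviation_less 2 A"
  have "antimono I" using I(2) by (simp add: antimono_iff_le_Suc)
  moreover have "range I \<subseteq> A" using I(1) by blast
  ultimately obtain m
    where m: "deviation_less (Suc 0) {J \<in> A. I (Suc m) \<subseteq> J \<and> J \<subseteq> I m}"
    using * unfolding numeral_2_eq_2 deviation_less.simps(2)[of "Suc 0"] by blast
  have "antimono (L m)" using L(2) by (auto simp: antimono_iff_le_Suc)
  moreover have "range (L m) \<subseteq> {J \<in> A. I (Suc m) \<subseteq> J \<and> J \<subseteq> I m}"
    using L(1) between by blast
  ultimately obtain k where k: "deviation_less 0
      {J \<in> {J \<in> A. I (Suc m) \<subseteq> J \<and> J \<subseteq> I m}. L m (Suc k) \<subseteq> J \<and> J \<subseteq> L m k}"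
    using m unfolding deviation_less.simps(2)[of 0] by blast
  have "L m (Suc k) \<in> {J \<in> {J \<in> A. I (Suc m) \<subseteq> J \<and> J \<subseteq> I m}. L m (Suc k) \<subseteq> J \<and> J \<subseteq> L m k}"
    and "L m k \<in> {J \<in> {J \<in> A. I (Suc m) \<subseteq> J \<and> J \<subseteq> I m}. L m (Suc k) \<subseteq> J \<and> J \<subseteq> L m k}"
    using L between by blast+
  with k L(2)[of m k] show False unfolding deviation_less.simps(1) by blast
qed

text \<open>The outer chain is \<open>(1 - u)\<^sup>m T\<close>, where \<open>T\<close> is the presented algebra; the inner chain, between
\<open>(1 - u)\<^sup>m\<^sup>+\<^sup>1 T\<close> and \<open>(1 - u)\<^sup>m T\<close>, is \<open>(1 - u)\<^sup>m\<^sup>+\<^sup>1 T + (1 - u)\<^sup>m (1 - v)\<^sup>k T\<close>. The inclusions are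
evident; the strictness of the inner chain is the purpose of \<open>P\<close>, which turns left multiplication by \<open>1 - u\<close> and
\<open>1 - v\<close> into multiplication by an indeterminate \<open>x\<close> and by a constant non-unit \<open>y\<close>. If the inner
chain were stationary at \<open>k\<close>, then \<open>y\<^sup>k = x P(a) + y\<^sup>k\<^sup>+\<^sup>1 P(b)\<close>, and the terms constant in \<open>x\<close>
would show that \<open>y\<close> divides \<open>1\<close>.\<close>

lemma not_deviation_less_2_if_detector:
  fixes rels :: "('g list \<Rightarrow>\<^sub>0 'f::field) set" and P :: "('g list \<Rightarrow>\<^sub>0 'f) \<Rightarrow> 'r::idom fps"
  assumes P_add: "\<And>x y. P (x + y) = P x + P y"
    and P_rel: "\<And>r a b. r \<in> rels \<Longrightarrow> P (a * r * b) = 0"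
    and P_u: "\<And>x. P (u * x) = (1 - fps_X) * P x"
    and P_v: "\<And>x. P (v * x) = fps_const (1 - y) * P x"
    and P_one: "P 1 = 1"
    and y: "y \<noteq> 0" "\<not> y dvd 1"
  shows "\<not> deviation_less 2 (right_ideals (presented_algebra rels))"
proof -
  have P_0: "P 0 = 0" by (metis P_add add_cancel_right_right)
  have P_minus: "P (x - z) = P x - P z" for x z
    by (metis P_add add_diff_cancel_right' diff_add_cancel)
  have P_x: "P ((1 - u) * x) = fps_X * P x" for x
    using P_minus[of x "u * x"] by (simp add: P_u left_diff_distrib)
  have P_y: "P ((1 - v) * x) = fps_const y * P x" for x
    using P_minus[of x "v * x"]
    by (simp add: P_v left_diff_distrib flip: fps_const_sub)
  have P_x': "P ((1 - u) ^ m * x) = fps_X ^ m * P x" for m x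
    by (induction m) (simp_all add: P_x mult.assoc)
  have P_y': "P ((1 - v) ^ m * x) = fps_const y ^ m * P x" for m x
    by (induction m) (simp_all add: P_y mult.assoc)
  have P_Idl: "P x = 0" if "x \<in> Idl\<^bsub>free_algebra\<^esub> rels" for x
  proof -
    have "Idl\<^bsub>free_algebra\<^esub> rels \<subseteq> {x. \<forall>a b. P (a * x * b) = 0}"
    proof (rule genideal_free_algebra_subset)
      fix a x assume "x \<in> {x. \<forall>a b. P (a * x * b) = 0}"
      then show "a * x \<in> {x. \<forall>a b. P (a * x * b) = 0}" "x * a \<in> {x. \<forall>a b. P (a * x * b) = 0}"
        by (auto simp: mult.assoc) (simp flip: mult.assoc)
    qed (auto simp: P_rel P_0 P_add distrib_left distrib_right)
    with that have "P (1 * x * 1) = 0" by blast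
    then show ?thesis by simp
  qed
  define I where "I m = range (\<lambda>a. (1 - u) ^ m * a)" for m
  define L where "L m k = {(1 - u) ^ Suc m * a + (1 - u) ^ m * (1 - v) ^ k * b | a b. True}" for m k
  let ?cl = "residue_class rels"
  have L_Suc: "L m (Suc k) \<subseteq> L m k" for m k
  proof
    fix x assume "x \<in> L m (Suc k)"
    then obtain a b where "x = (1 - u) ^ Suc m * a + (1 - u) ^ m * (1 - v) ^ Suc k * b"
      unfolding L_def by blast
    then have "x = (1 - u) ^ Suc m * a + (1 - u) ^ m * (1 - v) ^ k * ((1 - v) * b)"
      by (simp only: power_Suc2 mult.assoc)
    then show "x \<in> L m k" unfolding L_def by blast
  qed
  have strict: "?cl ` L m (Suc k) \<subset> ?cl ` L m k" for m k
  proof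
    show "?cl ` L m (Suc k) \<subseteq> ?cl ` L m k" using L_Suc by blast
    let ?x = "(1 - u) ^ m * (1 - v) ^ k"
    have "?x = (1 - u) ^ Suc m * 0 + (1 - u) ^ m * (1 - v) ^ k * 1" by simp
    then have "?x \<in> L m k" unfolding L_def by blast
    moreover have "?cl ?x \<notin> ?cl ` L m (Suc k)"
    proof
      assume "?cl ?x \<in> ?cl ` L m (Suc k)"
      then obtain a b
        where "?cl ?x = ?cl ((1 - u) ^ Suc m * a + (1 - u) ^ m * (1 - v) ^ Suc k * b)"
        unfolding L_def by auto
      then have "P (?x - ((1 - u) ^ Suc m * a + (1 - u) ^ m * (1 - v) ^ Suc k * b)) = 0"
        by (simp only: residue_class_eq_iff P_Idl)
      then have "P ((1 - u) ^ m * ((1 - v) ^ k * 1))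
          = P ((1 - u) ^ Suc m * a) + P ((1 - u) ^ m * ((1 - v) ^ Suc k * b))"
        by (simp only: P_minus P_add mult.assoc mult_1_right) simp
      then have "fps_X ^ m * (fps_const y ^ k) = fps_X ^ m * (fps_X * P a + fps_const y ^ Suc k * P b)"
        using P_y'[of k 1]
        by (simp only: P_x' P_y' P_one power_Suc2 [of fps_X] distrib_left mult.assoc mult_1_right)
      then have "fps_const y ^ k = fps_X * P a + fps_const y ^ Suc k * P b"
        by (rule mult_left_cancel [THEN iffD1, rotated]) simp
      then have "fps_nth (fps_const y ^ k) 0 = fps_nth (fps_X * P a + fps_const y ^ Suc k * P b) 0"
        by (rule arg_cong)
      then have "y ^ k = y ^ k * (y * fps_nth (P b) 0)"
        by (simp add: ac_simps del: mult_cancel_left1 mult_cancel_left2)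
      then have "1 = y * fps_nth (P b) 0" using y(1) by simp
      with y(2) show False by (metis dvdI)
    qed
    ultimately show "?cl ` L m (Suc k) \<noteq> ?cl ` L m k" by blast
  qed
  show ?thesis
  proof (rule not_deviation_less_2_if_chains)
    show "?cl ` I m \<in> right_ideals (presented_algebra rels)" for m
    proof (rule right_ideal_image)
      have "0 = (1 - u) ^ m * 0" by simp
      then show "0 \<in> I m" unfolding I_def by blast
      fix x z assume "x \<in> I m" "z \<in> I m"
      then obtain a a' where "x = (1 - u) ^ m * a" "z = (1 - u) ^ m * a'"
        unfolding I_def by blast
      then have "x + z = (1 - u) ^ m * (a + a')" by (simp add: distrib_left)
      then show "x + z \<in> I m" unfolding I_def by blast
    next
      fix c x assume "x \<in> I m"
      then obtain a where "x = (1 - u) ^ m * a" unfolding I_def by blast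
      then have "x * c = (1 - u) ^ m * (a * c)" by (simp add: mult.assoc)
      then show "x * c \<in> I m" unfolding I_def by blast
    qed
    show "?cl ` L m k \<in> right_ideals (presented_algebra rels)" for m k
    proof (rule right_ideal_image)
      have "0 = (1 - u) ^ Suc m * 0 + (1 - u) ^ m * (1 - v) ^ k * 0" by simp
      then show "0 \<in> L m k" unfolding L_def by blast
      fix x z assume "x \<in> L m k" "z \<in> L m k"
      then obtain a b a' b' where "x = (1 - u) ^ Suc m * a + (1 - u) ^ m * (1 - v) ^ k * b"
        "z = (1 - u) ^ Suc m * a' + (1 - u) ^ m * (1 - v) ^ k * b'"
        unfolding L_def by blast
      then have "x + z = (1 - u) ^ Suc m * (a + a') + (1 - u) ^ m * (1 - v) ^ k * (b + b')"
        by (simp add: distrib_left)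
      then show "x + z \<in> L m k" unfolding L_def by blast
    next
      fix c x assume "x \<in> L m k"
      then obtain a b where "x = (1 - u) ^ Suc m * a + (1 - u) ^ m * (1 - v) ^ k * b"
        unfolding L_def by blast
      then have "x * c = (1 - u) ^ Suc m * (a * c) + (1 - u) ^ m * (1 - v) ^ k * (b * c)"
        by (simp add: distrib_right mult.assoc)
      then show "x * c \<in> L m k" unfolding L_def by blast
    qed
    show "?cl ` I (Suc m) \<subseteq> ?cl ` I m" for m
    proof (rule image_mono, rule subsetI)
      fix x assume "x \<in> I (Suc m)"
      then obtain a where "x = (1 - u) ^ m * ((1 - u) * a)"
        by (auto simp: I_def power_Suc2 mult.assoc simp del: power_Suc)
      then show "x \<in> I m" unfolding I_def by blast
    qed
    show "?cl ` I (Suc m) \<subseteq> ?cl ` L m k" for m k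
    proof (rule image_mono, rule subsetI)
      fix x assume "x \<in> I (Suc m)"
      then obtain a where "x = (1 - u) ^ Suc m * a + (1 - u) ^ m * (1 - v) ^ k * 0"
        by (auto simp: I_def)
      then show "x \<in> L m k" unfolding L_def by blast
    qed
    show "?cl ` L m k \<subseteq> ?cl ` I m" for m k
    proof (rule image_mono, rule subsetI)
      fix x assume "x \<in> L m k"
      then obtain a b where "x = (1 - u) ^ Suc m * a + (1 - u) ^ m * (1 - v) ^ k * b"
        unfolding L_def by blast
      then have "x = (1 - u) ^ m * ((1 - u) * a + (1 - v) ^ k * b)"
        by (simp add: power_Suc2 distrib_left mult.assoc del: power_Suc)
      then show "x \<in> I m" unfolding I_def by blast
    qed
  qed (rule strict)
qed

text \<open>Integer powers of a unit \<open>u\<close> with inverse \<open>u'\<close> in a ring that need not be a field.\<close>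

definition zpow :: "'r::comm_ring_1 \<Rightarrow> 'r \<Rightarrow> int \<Rightarrow> 'r" where
  "zpow u u' k = u ^ nat k * u' ^ nat (- k)"

lemma zpow_0 [simp]: "zpow u u' 0 = 1"
  by (simp add: zpow_def)

lemma zpow_add_1:
  assumes "u * u' = 1"
  shows "zpow u u' (k + 1) = u * zpow u u' k"
proof (cases "k \<ge> 0")
  case True
  then show ?thesis by (simp add: zpow_def nat_add_distrib)
next
  case False
  then have "nat (- k) = Suc (nat (- (k + 1)))" by linarith
  moreover have "u * (u' * z) = z" for z using assms by (metis mult.assoc mult_1_left)
  ultimately show ?thesis using False by (simp add: zpow_def)
qed

text \<open>The function \<open>F\<close> is supported on the sublattice spanned by \<open>\<gamma>\<close> and \<open>\<delta>\<close>. There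
\<open>(X\<^sup>\<gamma>)\<^sup>a (X\<^sup>\<delta>)\<^sup>b\<close> is a multiple of the ordered monomial with exponent \<open>e = a \<gamma> + b \<delta>\<close>, and
\<open>F e\<close> is the image of this ordered monomial under \<open>X\<^sup>\<gamma> \<mapsto> U\<close>, \<open>X\<^sup>\<delta> \<mapsto> V\<close>. The two recursions are
compatible because \<open>\<gamma>\<close> and \<open>\<delta>\<close> commute, and \<open>F\<close> is well defined because they are independent.\<close>

lemma obtain_twisted_sublattice_function:
  fixes r :: "'n::finite \<Rightarrow> 'n \<Rightarrow> 'f::field" and \<kappa> :: "'f \<Rightarrow> 'r::comm_ring_1"
  assumes r: "\<And>i j. r i j \<noteq> 0"
    and indep: "\<forall>x y. (\<forall>i. x * \<gamma> i + y * \<delta> i = 0) \<longrightarrow> x = 0 \<and> y = 0"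
    and comm: "bichar r \<gamma> \<delta> = bichar r \<delta> \<gamma>"
    and \<kappa>: "\<And>c d. \<kappa> (c * d) = \<kappa> c * \<kappa> d" "\<kappa> 1 = 1"
    and units: "U * U' = 1" "V * V' = 1"
  obtains F where "F (\<lambda>_. 0) = 1"
    and "\<And>e. \<kappa> (bichar r \<gamma> e) * F (\<lambda>i. \<gamma> i + e i) = U * F e"
    and "\<And>e. \<kappa> (bichar r \<delta> e) * F (\<lambda>i. \<delta> i + e i) = V * F e"
proof -
  define comb where "comb = (\<lambda>(a, b) i. a * \<gamma> i + b * \<delta> i)"
  define tri where "tri a = a * (a - 1) div 2" for a :: int
  have tri: "tri (a + 1) = tri a + a" for a
  proof -
    have "(a + 1) * (a + 1 - 1) = a * (a - 1) + a * 2" by (simp add: algebra_simps)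
    then show ?thesis by (simp only: tri_def)
  qed
  define p \<rho> s where "p = bichar r \<gamma> \<gamma>" and "\<rho> = bichar r \<gamma> \<delta>" and "s = bichar r \<delta> \<delta>"
  have nz: "p \<noteq> 0" "\<rho> \<noteq> 0" "s \<noteq> 0"
    by (simp_all add: p_def \<rho>_def s_def bichar_nonzero r)
  \<comment> \<open>The exponents collect the factors picked up by one step at a time: going from
\<open>a\<close> to \<open>a + 1\<close> costs \<open>p\<^sup>-\<^sup>a \<rho>\<^sup>-\<^sup>b\<close>, going from \<open>b\<close> to \<open>b + 1\<close> costs \<open>\<rho>\<^sup>-\<^sup>a s\<^sup>-\<^sup>b\<close>.\<close>
  define G where "G = (\<lambda>(a, b). \<kappa> (p powi (- tri a) * \<rho> powi (- (a * b)) * s powi (- tri b))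
    * zpow U U' a * zpow V V' b)"
  define F where "F e = (if e \<in> range comb then G (inv_into UNIV comb e) else 0)" for e
  have "inj comb"
  proof (rule injI)
    fix x y assume "comb x = comb y"
    then have "(fst x - fst y) * \<gamma> i + (snd x - snd y) * \<delta> i = 0" for i
      by (auto simp: comb_def case_prod_beta fun_eq_iff algebra_simps dest: spec[of _ i])
    with indep have "fst x - fst y = 0 \<and> snd x - snd y = 0" by blast
    then show "x = y" by (simp add: prod_eq_iff)
  qed
  then have F_comb: "F (comb x) = G x" for x by (simp add: F_def)
  have comb_\<gamma>: "(\<lambda>i. \<gamma> i + comb (a, b) i) = comb (a + 1, b)" for a b
    by (simp add: comb_def algebra_simps)
  have comb_\<delta>: "(\<lambda>i. \<delta> i + comb (a, b) i) = comb (a, b + 1)" for a b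
    by (simp add: comb_def algebra_simps)
  have bi: "bichar r c (comb (a, b)) = bichar r c \<gamma> powi a * bichar r c \<delta> powi b" for a b c
    by (simp add: comb_def bichar_add_right bichar_scale_right r)
  show ?thesis
  proof (rule that)
    have "comb (0, 0) = (\<lambda>_. 0)" by (simp add: comb_def)
    then show "F (\<lambda>_. 0) = 1"
      using F_comb[of "(0, 0)"] by (simp add: G_def tri_def \<kappa>)
  next
    fix e
    show "\<kappa> (bichar r \<gamma> e) * F (\<lambda>i. \<gamma> i + e i) = U * F e"
    proof (cases "e \<in> range comb")
      case True
      then obtain a b where e: "e = comb (a, b)" by auto
      have "p powi a * \<rho> powi b * (p powi (- tri (a + 1)) * \<rho> powi (- ((a + 1) * b)) * s powi (- tri b))
          = (p powi a * p powi (- tri (a + 1))) * (\<rho> powi b * \<rho> powi (- ((a + 1) * b))) * s powi (- tri b)"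
        by (simp only: mult_ac)
      also have "\<dots> = p powi (- tri a) * \<rho> powi (- (a * b)) * s powi (- tri b)"
        using nz unfolding tri by (simp add: algebra_simps flip: power_int_add)
      finally have "\<kappa> (bichar r \<gamma> e) * G (a + 1, b) = U * G (a, b)"
        unfolding e bi G_def prod.case zpow_add_1[OF units(1)]
        by (simp only: p_def [symmetric] \<rho>_def [symmetric] mult.assoc [symmetric] \<kappa>(1) [symmetric])
          (simp only: mult_ac)
      then show ?thesis by (simp only: e comb_\<gamma> F_comb)
    next
      case False
      have "(\<lambda>i. \<gamma> i + e i) \<notin> range comb"
      proof
        assume "(\<lambda>i. \<gamma> i + e i) \<in> range comb"
        then obtain a b where "(\<lambda>i. \<gamma> i + e i) = comb (a, b)" by auto
        then have "e = comb (a - 1, b)"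
          by (auto simp: comb_def fun_eq_iff algebra_simps)
        with False show False by blast
      qed
      with False show ?thesis by (simp add: F_def)
    qed
  next
    fix e
    show "\<kappa> (bichar r \<delta> e) * F (\<lambda>i. \<delta> i + e i) = V * F e"
    proof (cases "e \<in> range comb")
      case True
      then obtain a b where e: "e = comb (a, b)" by auto
      have "\<rho> powi a * s powi b * (p powi (- tri a) * \<rho> powi (- (a * (b + 1))) * s powi (- tri (b + 1)))
          = p powi (- tri a) * (\<rho> powi a * \<rho> powi (- (a * (b + 1)))) * (s powi b * s powi (- tri (b + 1)))"
        by (simp only: mult_ac)
      also have "\<dots> = p powi (- tri a) * \<rho> powi (- (a * b)) * s powi (- tri b)"
        using nz unfolding tri by (simp add: algebra_simps flip: power_int_add)
      finally have "\<kappa> (bichar r \<delta> e) * G (a, b + 1) = V * G (a, b)"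
        unfolding e bi G_def prod.case zpow_add_1[OF units(2)]
        by (simp only: s_def [symmetric] \<rho>_def [symmetric] comm [symmetric] mult.assoc [symmetric] \<kappa>(1) [symmetric])
          (simp only: mult_ac)
      then show ?thesis by (simp only: e comb_\<delta> F_comb)
    next
      case False
      have "(\<lambda>i. \<delta> i + e i) \<notin> range comb"
      proof
        assume "(\<lambda>i. \<delta> i + e i) \<in> range comb"
        then obtain a b where "(\<lambda>i. \<delta> i + e i) = comb (a, b)" by auto
        then have "e = comb (a, b - 1)"
          by (auto simp: comb_def fun_eq_iff algebra_simps)
        with False show False by blast
      qed
      with False show ?thesis by (simp add: F_def)
    qed
  qed
qed


definition torus_weight :: "'n + 'n \<Rightarrow> 'n \<Rightarrow> int" where
  "torus_weight l = (case l of Inl i \<Rightarrow> unit_vec i | Inr i \<Rightarrow> (\<lambda>k. - unit_vec i k))"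

lemma torus_weight_simps [simp]:
  "torus_weight (Inl i) = unit_vec i" "torus_weight (Inr i) = (\<lambda>k. - unit_vec i k)"
  by (simp_all add: torus_weight_def)

lemma ex_word_of_weight: "\<exists>w. weight torus_weight w = (a :: 'n::finite \<Rightarrow> int)"
proof -
  have "\<exists>w. weight torus_weight w = (\<lambda>i. if i \<in> S then a i else 0)" if "finite S" for S
    using that
  proof (induction S rule: finite_induct)
    case empty
    show ?case by (rule exI[of _ "[]"]) simp
  next
    case (insert k S)
    then obtain w where w: "weight torus_weight w = (\<lambda>i. if i \<in> S then a i else 0)" by blast
    have pos: "weight torus_weight (replicate m (Inl k)) = (\<lambda>i. int m * unit_vec k i)" for m
      by (induction m) (simp_all add: distrib_right)
    have neg: "weight torus_weight (replicate m (Inr k)) = (\<lambda>i. - int m * unit_vec k i)" for m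
      by (induction m) (simp_all add: algebra_simps)
    have "weight torus_weight (replicate (nat (a k)) (Inl k) @ replicate (nat (- a k)) (Inr k) @ w)
        = (\<lambda>i. if i \<in> insert k S then a i else 0)"
      using insert by (auto simp: weight_append pos neg w unit_vec_def fun_eq_iff)
    then show ?case by blast
  qed
  from this[of UNIV] show ?thesis by simp
qed

text \<open>If \<open>X\<^sup>\<gamma>\<close> and \<open>X\<^sup>\<delta>\<close> commute, they span a commutative Laurent polynomial ring \<open>A\<close>, and the torus is
a free left \<open>A\<close>-module with one basis monomial for each coset of the lattice spanned by \<open>\<gamma>\<close>
and \<open>\<delta>\<close>. The detector is the projection onto \<open>A\<close> followed by the embedding of \<open>A\<close> into iterated
power series in which \<open>1 - X\<^sup>\<gamma>\<close> and \<open>1 - X\<^sup>\<delta>\<close> become the two indeterminates. It is defined on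
words and descends to the torus because it is compatible with the relations.\<close>

lemma not_deviation_less_2_quantum_torus:
  fixes q :: "'n::{finite,linorder} \<Rightarrow> 'n \<Rightarrow> 'f::field"
  assumes q: "mult_antisymmetric q"
    and comm: "bichar q \<gamma> \<delta> = 1"
    and indep: "\<forall>x y. (\<forall>i. x * \<gamma> i + y * \<delta> i = 0) \<longrightarrow> x = 0 \<and> y = 0"
  shows "\<not> deviation_less 2 (right_ideals (quantum_torus q))"
proof -
  define r where "r = lower q"
  note r = lower_nonzero[OF q, folded r_def]
  let ?wt = "weight torus_weight" and ?wc = "word_coeff r torus_weight"
  define \<kappa> :: "'f \<Rightarrow> 'f fps fps" where "\<kappa> c = fps_const (fps_const c)" for c
  have \<kappa>_mult: "\<kappa> (c * d) = \<kappa> c * \<kappa> d" and \<kappa>_add: "\<kappa> (c + d) = \<kappa> c + \<kappa> d"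
    and \<kappa>_0: "\<kappa> 0 = 0" and \<kappa>_1: "\<kappa> 1 = 1" for c d
    by (simp_all add: \<kappa>_def)
  have geometric: "(1 - fps_X) * Abs_fps (\<lambda>_. 1) = (1 :: 'a::comm_ring_1 fps)"
    by (rule fps_ext) (simp add: left_diff_distrib fps_X_mult_nth split: nat.split)
  have geometric': "fps_const (1 - fps_X) * fps_const (Abs_fps (\<lambda>_. 1)) = (1 :: 'f fps fps)"
    by (simp add: geometric)
  have comm': "bichar r \<gamma> \<delta> = bichar r \<delta> \<gamma>"
    using bichar_lower_commute[OF q, of \<gamma> \<delta>] comm by (simp add: r_def)
  obtain F where F_0: "F (\<lambda>_. 0) = 1"
    and F_\<gamma>: "\<And>e. \<kappa> (bichar r \<gamma> e) * F (\<lambda>i. \<gamma> i + e i) = (1 - fps_X) * F e"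
    and F_\<delta>: "\<And>e. \<kappa> (bichar r \<delta> e) * F (\<lambda>i. \<delta> i + e i) = fps_const (1 - fps_X) * F e"
    using obtain_twisted_sublattice_function[OF r indep comm' \<kappa>_mult \<kappa>_1 geometric geometric']
    by blast
  \<comment> \<open>A word is its coefficient times the ordered monomial of its weight, and \<open>F\<close> gives the image
of the latter.\<close>
  define P where "P = lin_ext (\<lambda>w c. \<kappa> (c * ?wc w) * F (?wt w))"
  have P_single: "P (Poly_Mapping.single w c) = \<kappa> (c * ?wc w) * F (?wt w)" for w c
    unfolding P_def by (rule lin_ext_single) (simp add: \<kappa>_0)
  have P_add: "P (x + y) = P x + P y" for x y
    unfolding P_def by (rule lin_ext_add) (simp_all add: \<kappa>_0 \<kappa>_add distrib_right)
  have P_minus: "P (x - y) = P x - P y" for x y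
    by (metis P_add add_diff_cancel_right' diff_add_cancel)
  have P_context: "P (Poly_Mapping.single v a
        * (Poly_Mapping.single m 1 - Poly_Mapping.single m' c) * Poly_Mapping.single w b) = 0"
    if "?wt m = ?wt m'" "?wc m = c * ?wc m'" for v a m m' c w b
  proof -
    have "?wc (v @ m @ w) = c * ?wc (v @ m' @ w)"
      using r that by (rule word_coeff_context)
    then show ?thesis using that(1)
      by (simp add: left_diff_distrib right_diff_distrib word_mult_single P_minus P_single
          weight_append mult_ac)
  qed
  have P_rel: "P (a * \<rho> * b) = 0" if rel: "\<rho> \<in> torus_relations q" for \<rho> a b
  proof (rule vanish_on_sandwich[OF P_add])
    fix v c w d
    consider i j where "i < j" "\<rho> = gen (Inl i) * gen (Inl j) - const (q i j) * gen (Inl j) * gen (Inl i)"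
      | i where "\<rho> = gen (Inl i) * gen (Inr i) - 1"
      | i where "\<rho> = gen (Inr i) * gen (Inl i) - 1"
      using rel unfolding torus_relations_def by blast
    then show "P (Poly_Mapping.single v c * \<rho> * Poly_Mapping.single w d) = 0"
    proof cases
      case 1
      have "?wc [Inl i, Inl j] = q i j * ?wc [Inl j, Inl i]"
        using 1(1) mult_antisymmetricD[OF q]
        by (simp add: bichar_unit_unit r_def lower_def)
      moreover have "?wt [Inl i, Inl j] = ?wt [Inl j, Inl i]" by (simp add: add.commute)
      ultimately show ?thesis
        using P_context[of "[Inl i, Inl j]" "[Inl j, Inl i]" "q i j" v c w d]
        by (simp add: 1(2) gen_def const_def word_mult_single)
    next
      case 2
      have "?wc [Inl i, Inr i] = 1 * ?wc []"
        using bichar_scale_right[of r "unit_vec i" "-1" "unit_vec i"]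
        by (simp add: bichar_unit_unit r_def lower_def)
      moreover have "?wt [Inl i, Inr i] = ?wt []" by simp
      ultimately show ?thesis
        using P_context[of "[Inl i, Inr i]" "[]" 1 v c w d]
        by (simp add: 2 gen_def one_eq_single_Nil word_mult_single)
    next
      case 3
      have "?wc [Inr i, Inl i] = 1 * ?wc []"
        using bichar_scale_left[of r "-1" "unit_vec i" "unit_vec i"]
        by (simp add: bichar_unit_unit r_def lower_def)
      moreover have "?wt [Inr i, Inl i] = ?wt []" by simp
      ultimately show ?thesis
        using P_context[of "[Inr i, Inl i]" "[]" 1 v c w d]
        by (simp add: 3 gen_def one_eq_single_Nil word_mult_single)
    qed
  qed
  \<comment> \<open>The word is divided by its straightening factor, so that it represents the ordered monomial.\<close>
  have P_monomial: "P (Poly_Mapping.single w (inverse (?wc w)) * x) = U * P x"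
    if "\<And>e. \<kappa> (bichar r (?wt w) e) * F (\<lambda>i. ?wt w i + e i) = U * F e" for w U x
  proof (induction x rule: poly_mapping_add_induct)
    case (single v c)
    have "inverse (?wc w) * c * ?wc (w @ v) = c * ?wc v * bichar r (?wt w) (?wt v)"
      using word_coeff_nonzero[of r torus_weight w, OF r] word_coeff_append[of r torus_weight w v, OF r]
      by (simp add: mult_ac)
    then have "P (Poly_Mapping.single w (inverse (?wc w)) * Poly_Mapping.single v c)
        = \<kappa> (c * ?wc v) * (\<kappa> (bichar r (?wt w) (?wt v)) * F (\<lambda>i. ?wt w i + ?wt v i))"
      by (simp only: word_mult_single P_single weight_append \<kappa>_mult mult.assoc)
    then show ?case by (simp only: that P_single mult_ac)
  next
    case (add x y)
    then show ?case by (simp only: distrib_left P_add)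
  qed
  obtain w\<^sub>1 w\<^sub>2 where w: "?wt w\<^sub>1 = \<gamma>" "?wt w\<^sub>2 = \<delta>"
    using ex_word_of_weight by metis
  show ?thesis
    unfolding quantum_torus_def
  proof (rule not_deviation_less_2_if_detector[of P, OF P_add P_rel])
    show "P (Poly_Mapping.single w\<^sub>1 (inverse (?wc w\<^sub>1)) * x) = (1 - fps_X) * P x" for x
      by (rule P_monomial) (simp only: w F_\<gamma>)
    show "P (Poly_Mapping.single w\<^sub>2 (inverse (?wc w\<^sub>2)) * x) = fps_const (1 - fps_X) * P x" for x
      by (rule P_monomial) (simp only: w F_\<delta>)
    show "P 1 = 1"
      by (simp add: one_eq_single_Nil P_single F_0 \<kappa>_1)
    show "(fps_X :: 'f fps) \<noteq> 0" by simp
    show "\<not> (fps_X :: 'f fps) dvd 1"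
    proof
      assume "(fps_X :: 'f fps) dvd 1"
      then obtain z :: "'f fps" where "1 = fps_X * z" by (elim dvdE)
      then have "fps_nth 1 0 = fps_nth (fps_X * z) 0" by simp
      then show False by simp
    qed
  qed
qed

theorem krull_dim_one_imp_nondegenerate:
  assumes "mult_antisymmetric q" "has_krull_dim (quantum_torus q) 1"
  shows "nondegenerate q"
  unfolding nondegenerate_def
proof (intro allI impI, rule ccontr)
  fix a b
  assume "bichar q a b = 1" "\<not> (\<exists>x y. (x \<noteq> 0 \<or> y \<noteq> 0) \<and> (\<forall>i. x * a i + y * b i = 0))"
  then have "\<not> deviation_less 2 (right_ideals (quantum_torus q))"
    by (intro not_deviation_less_2_quantum_torus[OF assms(1)]) blast+
  with assms(2) show False by (simp add: has_krull_dim_def numeral_2_eq_2)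
qed

section \<open>Twisted polynomials\<close>

text \<open>Monomials of the affine space are indexed by multisets of letters, whose multiset order is linear
and compatible with addition; the bicharacters live on integer exponents.\<close>

definition mexp :: "'n multiset \<Rightarrow> 'n \<Rightarrow> int" where
  "mexp A = (\<lambda>i. int (count A i))"

lemma mexp_simps [simp]:
  "mexp {#} = (\<lambda>_. 0)" "mexp {#i#} = unit_vec i"
  "mexp (A + B) = (\<lambda>i. mexp A i + mexp B i)"
  "mexp (add_mset i A) = (\<lambda>k. unit_vec i k + mexp A k)"
  by (auto simp: mexp_def unit_vec_def)

lemma mexp_inject: "mexp A = mexp B \<longleftrightarrow> A = B"
  by (auto simp: mexp_def fun_eq_iff multiset_eq_iff)

definition cocycle :: "('n::{finite,linorder} \<Rightarrow> 'n \<Rightarrow> 'f::field) \<Rightarrow> 'n multiset \<Rightarrow> 'n multiset \<Rightarrow> 'f" where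
  "cocycle q A B = bichar (lower q) (mexp A) (mexp B)"

text \<open>The product of the quantum affine space in the basis of ordered monomials.\<close>

definition star ::
    "('n::{finite,linorder} \<Rightarrow> 'n \<Rightarrow> 'f::field) \<Rightarrow> ('n multiset \<Rightarrow>\<^sub>0 'f) \<Rightarrow> ('n multiset \<Rightarrow>\<^sub>0 'f) \<Rightarrow> ('n multiset \<Rightarrow>\<^sub>0 'f)" where
  "star q f g = lin_ext (\<lambda>A a. lin_ext (\<lambda>B b. Poly_Mapping.single (A + B) (cocycle q A B * a * b)) g) f"

abbreviation var :: "'n \<Rightarrow> ('n multiset \<Rightarrow>\<^sub>0 'f::field)" where
  "var i \<equiv> Poly_Mapping.single {#i#} 1"

lemma star_add_left: "star q (f + f') g = star q f g + star q f' g"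
  unfolding star_def
proof (rule lin_ext_add)
  fix A and a b :: 'b
  show "lin_ext (\<lambda>B c. Poly_Mapping.single (A + B) (cocycle q A B * (a + b) * c)) g
      = lin_ext (\<lambda>B c. Poly_Mapping.single (A + B) (cocycle q A B * a * c)) g
        + lin_ext (\<lambda>B c. Poly_Mapping.single (A + B) (cocycle q A B * b * c)) g"
    by (simp add: lin_ext_def sum.distrib distrib_left distrib_right single_add)
qed (simp add: lin_ext_def)

lemma star_add_right: "star q f (g + g') = star q f g + star q f g'"
proof -
  have "lin_ext (\<lambda>B b. Poly_Mapping.single (A + B) (cocycle q A B * a * b)) (g + g')
      = lin_ext (\<lambda>B b. Poly_Mapping.single (A + B) (cocycle q A B * a * b)) g
        + lin_ext (\<lambda>B b. Poly_Mapping.single (A + B) (cocycle q A B * a * b)) g'" for A a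
    by (rule lin_ext_add) (simp_all add: distrib_left single_add)
  then show ?thesis by (simp add: star_def lin_ext_def sum.distrib)
qed

lemma star_zero_left [simp]: "star q 0 g = 0"
  by (simp add: star_def)

lemma star_zero_right [simp]: "star q f 0 = 0"
  by (simp add: star_def lin_ext_def)

lemma star_single:
  "star q (Poly_Mapping.single A a) (Poly_Mapping.single B b)
     = Poly_Mapping.single (A + B) (cocycle q A B * a * b)"
  by (simp add: star_def lin_ext_single)

lemma cocycle_empty [simp]: "cocycle q {#} B = 1" "cocycle q A {#} = 1"
  by (simp_all add: cocycle_def)

lemma cocycle_nonzero: "mult_antisymmetric q \<Longrightarrow> cocycle q A B \<noteq> 0"
  by (simp add: cocycle_def bichar_nonzero lower_nonzero)

lemma lookup_star:
  "Poly_Mapping.lookup (star q f g) C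
     = (\<Sum>(A, B)\<in>Poly_Mapping.keys f \<times> Poly_Mapping.keys g.
          if A + B = C then cocycle q A B * Poly_Mapping.lookup f A * Poly_Mapping.lookup g B else 0)"
  by (simp add: star_def lin_ext_def lookup_sum lookup_single when_def
      flip: sum.cartesian_product)

text \<open>No cancellation takes place at an exponent that arises from one pair of monomials only.\<close>

lemma lookup_star_unique:
  assumes "A \<in> Poly_Mapping.keys f" "B \<in> Poly_Mapping.keys g"
    and "\<And>A' B'. A' \<in> Poly_Mapping.keys f \<Longrightarrow> B' \<in> Poly_Mapping.keys g \<Longrightarrow> A' + B' = A + B
      \<Longrightarrow> A' = A \<and> B' = B"
  shows "Poly_Mapping.lookup (star q f g) (A + B)
    = cocycle q A B * Poly_Mapping.lookup f A * Poly_Mapping.lookup g B"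
proof -
  have "Poly_Mapping.lookup (star q f g) (A + B) = (\<Sum>(A', B')\<in>{(A, B)}.
      if A' + B' = A + B then cocycle q A' B' * Poly_Mapping.lookup f A' * Poly_Mapping.lookup g B' else 0)"
    unfolding lookup_star
  proof (rule sum.mono_neutral_right)
    show "{(A, B)} \<subseteq> Poly_Mapping.keys f \<times> Poly_Mapping.keys g"
      using assms(1,2) by simp
    show "\<forall>p\<in>Poly_Mapping.keys f \<times> Poly_Mapping.keys g - {(A, B)}.
        (case p of (A', B') \<Rightarrow> if A' + B' = A + B
          then cocycle q A' B' * Poly_Mapping.lookup f A' * Poly_Mapping.lookup g B' else 0) = 0"
    proof
      fix p assume "p \<in> Poly_Mapping.keys f \<times> Poly_Mapping.keys g - {(A, B)}"
      moreover obtain A' B' where p: "p = (A', B')" by fastforce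
      ultimately have "A' + B' \<noteq> A + B" using assms(3)[of A' B'] by blast
      then show "(case p of (A', B') \<Rightarrow> if A' + B' = A + B
          then cocycle q A' B' * Poly_Mapping.lookup f A' * Poly_Mapping.lookup g B' else 0) = 0"
        by (simp add: p)
    qed
  qed simp
  then show ?thesis by simp
qed

lemma keys_star_subset:
  "Poly_Mapping.keys (star q f g) \<subseteq> {A + B | A B. A \<in> Poly_Mapping.keys f \<and> B \<in> Poly_Mapping.keys g}"
proof
  fix C assume "C \<in> Poly_Mapping.keys (star q f g)"
  then have "(\<Sum>(A, B)\<in>Poly_Mapping.keys f \<times> Poly_Mapping.keys g.
      if A + B = C then cocycle q A B * Poly_Mapping.lookup f A * Poly_Mapping.lookup g B else 0) \<noteq> 0"
    by (simp add: in_keys_iff lookup_star)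
  then obtain p where "p \<in> Poly_Mapping.keys f \<times> Poly_Mapping.keys g"
    "(case p of (A, B) \<Rightarrow>
      if A + B = C then cocycle q A B * Poly_Mapping.lookup f A * Poly_Mapping.lookup g B else 0) \<noteq> 0"
    by (rule sum.not_neutral_contains_not_neutral)
  then obtain A B where "A \<in> Poly_Mapping.keys f" "B \<in> Poly_Mapping.keys g" "C = A + B"
    by (auto split: if_splits)
  then show "C \<in> {A + B | A B. A \<in> Poly_Mapping.keys f \<and> B \<in> Poly_Mapping.keys g}" by blast
qed

text \<open>The multiset order is compatible with addition, so the largest exponents of the factors
meet in no other pair with the same sum. In particular there are no zero divisors.\<close>

lemma Max_keys_star:
  fixes f g :: "'n::{finite,linorder} multiset \<Rightarrow>\<^sub>0 'f::field"
  assumes q: "mult_antisymmetric q" and "f \<noteq> 0" "g \<noteq> 0"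
  shows "star q f g \<noteq> 0"
    and "Max (Poly_Mapping.keys (star q f g)) = Max (Poly_Mapping.keys f) + Max (Poly_Mapping.keys g)"
proof -
  let ?A = "Max (Poly_Mapping.keys f)" and ?B = "Max (Poly_Mapping.keys g)"
  have AB: "?A \<in> Poly_Mapping.keys f" "?B \<in> Poly_Mapping.keys g"
    using assms by (auto intro!: Max_in)
  have le: "A \<le> ?A" "B \<le> ?B" if "A \<in> Poly_Mapping.keys f" "B \<in> Poly_Mapping.keys g" for A B
    using that by auto
  have "A = ?A \<and> B = ?B" if "A \<in> Poly_Mapping.keys f" "B \<in> Poly_Mapping.keys g" "A + B = ?A + ?B" for A B
    using le[OF that(1,2)] that(3)
    by (metis add_less_le_mono add_le_less_mono less_irrefl order_le_less)
  then have "Poly_Mapping.lookup (star q f g) (?A + ?B)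
      = cocycle q ?A ?B * Poly_Mapping.lookup f ?A * Poly_Mapping.lookup g ?B"
    by (rule lookup_star_unique[OF AB])
  then have in_keys: "?A + ?B \<in> Poly_Mapping.keys (star q f g)"
    using AB cocycle_nonzero[OF q] by (simp add: in_keys_iff)
  then show "star q f g \<noteq> 0" by auto
  show "Max (Poly_Mapping.keys (star q f g)) = ?A + ?B"
  proof (rule Max_eqI)
    fix C assume "C \<in> Poly_Mapping.keys (star q f g)"
    then obtain A B where "A \<in> Poly_Mapping.keys f" "B \<in> Poly_Mapping.keys g" "C = A + B"
      using keys_star_subset[of q f g] by blast
    then show "C \<le> ?A + ?B" using le by (simp add: add_mono)
  qed (use in_keys in simp_all)
qed

lemma Min_keys_star:
  fixes f g :: "'n::{finite,linorder} multiset \<Rightarrow>\<^sub>0 'f::field"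
  assumes q: "mult_antisymmetric q" and "f \<noteq> 0" "g \<noteq> 0"
  shows "Min (Poly_Mapping.keys (star q f g)) = Min (Poly_Mapping.keys f) + Min (Poly_Mapping.keys g)"
proof -
  let ?A = "Min (Poly_Mapping.keys f)" and ?B = "Min (Poly_Mapping.keys g)"
  have AB: "?A \<in> Poly_Mapping.keys f" "?B \<in> Poly_Mapping.keys g"
    using assms by (auto intro!: Min_in)
  have le: "?A \<le> A" "?B \<le> B" if "A \<in> Poly_Mapping.keys f" "B \<in> Poly_Mapping.keys g" for A B
    using that by auto
  have "A = ?A \<and> B = ?B" if "A \<in> Poly_Mapping.keys f" "B \<in> Poly_Mapping.keys g" "A + B = ?A + ?B" for A B
    using le[OF that(1,2)] that(3)
    by (metis add_less_le_mono add_le_less_mono less_irrefl order_le_less)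
  then have "Poly_Mapping.lookup (star q f g) (?A + ?B)
      = cocycle q ?A ?B * Poly_Mapping.lookup f ?A * Poly_Mapping.lookup g ?B"
    by (rule lookup_star_unique[OF AB])
  then have in_keys: "?A + ?B \<in> Poly_Mapping.keys (star q f g)"
    using AB cocycle_nonzero[OF q] by (simp add: in_keys_iff)
  show ?thesis
  proof (rule Min_eqI)
    fix C assume "C \<in> Poly_Mapping.keys (star q f g)"
    then obtain A B where "A \<in> Poly_Mapping.keys f" "B \<in> Poly_Mapping.keys g" "C = A + B"
      using keys_star_subset[of q f g] by blast
    then show "?A + ?B \<le> C" using le by (simp add: add_mono)
  qed (use in_keys in simp_all)
qed

section \<open>Normal elements\<close>

text \<open>One half of the condition \<open>u R = R u\<close>, tested on the generators.\<close>

definition normal_element ::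
    "('n::{finite,linorder} \<Rightarrow> 'n \<Rightarrow> 'f::field) \<Rightarrow> ('n multiset \<Rightarrow>\<^sub>0 'f) \<Rightarrow> bool" where
  "normal_element q u \<longleftrightarrow> u \<noteq> 0 \<and> (\<forall>j. \<exists>a. star q u (var j) = star q a u)"

lemma eq_single_if_keys_subset:
  "Poly_Mapping.keys f \<subseteq> {A} \<Longrightarrow> f = Poly_Mapping.single A (Poly_Mapping.lookup f A)"
  by (rule poly_mapping_eqI) (auto simp: lookup_single when_def in_keys_iff)

text \<open>Comparing the largest exponents on both sides, and likewise the smallest ones, shows
that largest and smallest exponent of \<open>a\<close> are both that of \<open>X\<^sub>j\<close>.\<close>

lemma normalizer_is_scaled_var:
  fixes u :: "'n::{finite,linorder} multiset \<Rightarrow>\<^sub>0 'f::field"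
  assumes q: "mult_antisymmetric q" and u: "u \<noteq> 0" and eq: "star q u (var j) = star q a u"
  obtains c where "c \<noteq> 0" "a = Poly_Mapping.single {#j#} c"
proof -
  have var: "var j \<noteq> (0 :: 'n multiset \<Rightarrow>\<^sub>0 'f)" by (metis lookup_single_eq lookup_zero zero_neq_one)
  have a: "a \<noteq> 0"
    using Max_keys_star(1)[OF q u var] eq by auto
  have "Max (Poly_Mapping.keys a) + Max (Poly_Mapping.keys u) = {#j#} + Max (Poly_Mapping.keys u)"
    using Max_keys_star(2)[OF q a u] Max_keys_star(2)[OF q u var] eq by simp
  then have max: "Max (Poly_Mapping.keys a) = {#j#}" by (simp only: add_right_cancel)
  have "Min (Poly_Mapping.keys a) + Min (Poly_Mapping.keys u) = {#j#} + Min (Poly_Mapping.keys u)"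
    using Min_keys_star[OF q a u] Min_keys_star[OF q u var] eq by simp
  then have min: "Min (Poly_Mapping.keys a) = {#j#}" by (simp only: add_right_cancel)
  have "A = {#j#}" if "A \<in> Poly_Mapping.keys a" for A
    using Max_ge[OF finite_keys that] Min_le[OF finite_keys that] max min by (metis order.antisym)
  then have a_eq: "a = Poly_Mapping.single {#j#} (Poly_Mapping.lookup a {#j#})"
    by (intro eq_single_if_keys_subset) auto
  with a have "Poly_Mapping.lookup a {#j#} \<noteq> 0" by (metis single_zero)
  with a_eq show ?thesis by (rule that[rotated])
qed

text \<open>From \<open>u X\<^sub>j = c X\<^sub>j u\<close>, comparison of coefficients shows that each monomial of \<open>u\<close> commutes with \<open>X\<^sub>j\<close>
up to the same factor \<open>c\<close>.\<close>

lemma bichar_const_on_normal_support: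
  fixes u :: "'n::{finite,linorder} multiset \<Rightarrow>\<^sub>0 'f::field"
  assumes q: "mult_antisymmetric q" and u: "normal_element q u"
    and A: "A \<in> Poly_Mapping.keys u" "B \<in> Poly_Mapping.keys u"
  shows "bichar q (mexp A) (unit_vec j) = bichar q (mexp B) (unit_vec j)"
proof -
  obtain a where "star q u (var j) = star q a u"
    using u by (auto simp: normal_element_def)
  with q u obtain c where c: "c \<noteq> 0" "star q u (var j) = star q (Poly_Mapping.single {#j#} c) u"
    by (metis normal_element_def normalizer_is_scaled_var)
  have "bichar q (mexp A) (unit_vec j) = c" if "A \<in> Poly_Mapping.keys u" for A
  proof -
    have "Poly_Mapping.lookup (star q u (var j)) (A + {#j#})
        = cocycle q A {#j#} * Poly_Mapping.lookup u A * 1"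
      using that by (subst lookup_star_unique) auto
    moreover have "Poly_Mapping.lookup (star q (Poly_Mapping.single {#j#} c) u) ({#j#} + A)
        = cocycle q {#j#} A * c * Poly_Mapping.lookup u A"
      using that c(1) by (subst lookup_star_unique) auto
    moreover have "cocycle q A {#j#} = bichar q (mexp A) (unit_vec j) * cocycle q {#j#} A"
      unfolding cocycle_def mexp_simps add_0_right by (rule bichar_lower_commute[OF q])
    ultimately have "bichar q (mexp A) (unit_vec j) * (cocycle q {#j#} A * Poly_Mapping.lookup u A)
        = c * (cocycle q {#j#} A * Poly_Mapping.lookup u A)"
      using c(2) by (simp add: mult_ac)
    moreover have "cocycle q {#j#} A * Poly_Mapping.lookup u A \<noteq> 0"
      using cocycle_nonzero[OF q] that by (simp add: in_keys_iff)
    ultimately show ?thesis by (rule mult_right_cancel[THEN iffD1, rotated])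
  qed
  with A show ?thesis by simp
qed

text \<open>A vector orthogonal to \<open>unit_vec j\<close> is a multiple of it, and with at least two indices no nonzero
vector is a multiple of every unit vector. With a single variable this fails, in
accordance with the automorphisms \<open>X \<mapsto> a X + b\<close> of the polynomial ring.\<close>

lemma nondegenerate_radical:
  fixes q :: "'n::finite \<Rightarrow> 'n \<Rightarrow> 'f::field"
  assumes "nondegenerate q" "CARD('n) \<ge> 2" and d: "\<And>j. bichar q d (unit_vec j) = 1"
  shows "d k = 0"
proof -
  have "\<exists>j. j \<noteq> k"
  proof (rule ccontr)
    assume "\<not> (\<exists>j. j \<noteq> k)"
    then have "(UNIV :: 'n set) = {k}" by auto
    then have "CARD('n) = card {k}" by (rule arg_cong)
    with assms(2) show False by simp
  qed
  then obtain j where "j \<noteq> k" ..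
  obtain x y where xy: "x \<noteq> 0 \<or> y \<noteq> 0" "\<forall>i. x * d i + y * unit_vec j i = 0"
    using assms(1) d[of j] unfolding nondegenerate_def by blast
  from xy(2) \<open>j \<noteq> k\<close> have "x * d k = 0" "x * d j + y = 0"
    by (auto simp: unit_vec_def dest: spec[of _ j] spec[of _ k])
  with xy(1) show ?thesis by auto
qed

text \<open>The difference of two exponents of a normal element is orthogonal to all unit vectors, hence
zero.\<close>

lemma normal_element_imp_monomial:
  fixes q :: "'n::{finite,linorder} \<Rightarrow> 'n \<Rightarrow> 'f::field"
  assumes q: "mult_antisymmetric q" "nondegenerate q" "CARD('n) \<ge> 2"
    and u: "normal_element q u"
  obtains A c where "c \<noteq> 0" "u = Poly_Mapping.single A c"
proof -
  have "u \<noteq> 0" using u by (simp add: normal_element_def)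
  then obtain A where A: "A \<in> Poly_Mapping.keys u" by (metis keys_eq_empty equals0I)
  have "B = A" if B: "B \<in> Poly_Mapping.keys u" for B
  proof -
    note nonzero = mult_antisymmetricD(1)[OF q(1)]
    have "bichar q (\<lambda>i. mexp B i + (-1) * mexp A i) (unit_vec j)
        = bichar q (mexp B) (unit_vec j) * bichar q (mexp A) (unit_vec j) powi (-1)" for j
      by (simp only: bichar_add_left[OF nonzero] bichar_scale_left)
    then have "bichar q (\<lambda>i. mexp B i + (-1) * mexp A i) (unit_vec j) = 1" for j
      using bichar_const_on_normal_support[OF q(1) u B A, of j] nonzero
      by (simp add: bichar_nonzero)
    from nondegenerate_radical[OF q(2,3) this] have "mexp B = mexp A"
      by (auto simp: fun_eq_iff)
    then show ?thesis by (simp add: mexp_inject)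
  qed
  then have "u = Poly_Mapping.single A (Poly_Mapping.lookup u A)"
    by (intro eq_single_if_keys_subset) auto
  with A show ?thesis by (intro that) (auto simp: in_keys_iff)
qed

text \<open>Moving \<open>X\<^sub>i\<close> past a monomial changes only the coefficient of that monomial.\<close>

lemma var_star_eq_star_var:
  assumes q: "mult_antisymmetric q"
  shows "\<exists>g. star q (var i) f = star q g (var i)"
proof (induction f rule: poly_mapping_add_induct)
  case (single B b)
  have "star q (var i) (Poly_Mapping.single B b)
      = star q (Poly_Mapping.single B (cocycle q {#i#} B * b / cocycle q B {#i#})) (var i)"
    using cocycle_nonzero[OF q] by (simp add: star_single add.commute)
  then show ?case ..
next
  case (add f f')
  then show ?case by (metis star_add_left star_add_right)
qed

section \<open>Automorphisms of the twisted polynomial algebra\<close>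

text \<open>Fixing the scalars \<open>single {#} c\<close> and being multiplicative amounts to being linear and unital.\<close>

definition twisted_aut ::
    "('n::{finite,linorder} \<Rightarrow> 'n \<Rightarrow> 'f::field) \<Rightarrow> (('n multiset \<Rightarrow>\<^sub>0 'f) \<Rightarrow> ('n multiset \<Rightarrow>\<^sub>0 'f)) \<Rightarrow> bool" where
  "twisted_aut q \<psi> \<longleftrightarrow> bij \<psi> \<and> (\<forall>f g. \<psi> (f + g) = \<psi> f + \<psi> g)
     \<and> (\<forall>f g. \<psi> (star q f g) = star q (\<psi> f) (\<psi> g))
     \<and> (\<forall>c. \<psi> (Poly_Mapping.single {#} c) = Poly_Mapping.single {#} c)"

lemma twisted_autD:
  assumes "twisted_aut q \<psi>"
  shows "bij \<psi>" "\<psi> (f + g) = \<psi> f + \<psi> g" "\<psi> (star q f g) = star q (\<psi> f) (\<psi> g)"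
    "\<psi> (Poly_Mapping.single {#} c) = Poly_Mapping.single {#} c" "inj \<psi>" "surj \<psi>" "\<psi> 0 = 0" "\<psi> 1 = 1"
proof -
  show *: "bij \<psi>" "\<psi> (f + g) = \<psi> f + \<psi> g" "\<psi> (star q f g) = star q (\<psi> f) (\<psi> g)"
    "\<psi> (Poly_Mapping.single {#} c) = Poly_Mapping.single {#} c" for f g c
    using assms by (auto simp: twisted_aut_def)
  from * show "inj \<psi>" "surj \<psi>" by (auto simp: bij_def)
  show "\<psi> 0 = 0" "\<psi> 1 = 1" using *(4)[of 0] *(4)[of 1] by simp_all
qed

lemma twisted_aut_inv:
  assumes "twisted_aut q \<psi>"
  shows "twisted_aut q (inv_into UNIV \<psi>)"
proof -
  note \<psi> = twisted_autD[OF assms]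
  have inv: "inv_into UNIV \<psi> g = f" if "\<psi> f = g" for f g
    using that \<psi>(5) by (metis inv_f_f)
  have \<psi>_inv: "\<psi> (inv_into UNIV \<psi> f) = f" for f
    using \<psi>(6) by (rule surj_f_inv_f)
  show ?thesis
    unfolding twisted_aut_def
    using \<psi>(1) by (auto intro!: inv bij_imp_bij_inv simp: \<psi>(2-4) \<psi>_inv)
qed

text \<open>Variables are normal, and automorphisms preserve normality.\<close>

lemma twisted_aut_var_normal:
  assumes q: "mult_antisymmetric q" and "twisted_aut q \<psi>"
  shows "normal_element q (\<psi> (var i))"
  unfolding normal_element_def
proof (intro conjI allI)
  note \<psi> = twisted_autD[OF assms(2)]
  have "var i \<noteq> 0" by (metis lookup_single_eq lookup_zero zero_neq_one)
  then show "\<psi> (var i) \<noteq> 0" using \<psi>(5,7) by (metis injD)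
  fix j
  obtain f where f: "\<psi> f = var j" using \<psi>(6) by (metis surjD)
  obtain g where "star q (var i) f = star q g (var i)" using var_star_eq_star_var[OF q] by blast
  then have "star q (\<psi> (var i)) (var j) = star q (\<psi> g) (\<psi> (var i))"
    by (metis f \<psi>(3))
  then show "\<exists>a. star q (\<psi> (var i)) (var j) = star q a (\<psi> (var i))" ..
qed

text \<open>Peeling off one variable, for induction on the exponent.\<close>

lemma single_add_mset_eq_star:
  assumes "mult_antisymmetric q"
  shows "Poly_Mapping.single (add_mset i B) b
    = star q (var i) (Poly_Mapping.single B (b / cocycle q {#i#} B))"
  using cocycle_nonzero[OF assms] by (simp add: star_single)

lemma twisted_aut_monomial:
  assumes q: "mult_antisymmetric q" and \<psi>: "twisted_aut q \<psi>"
    and var: "\<And>i. \<psi> (var i) = Poly_Mapping.single (A i) (c i)"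
  shows "\<exists>d. \<psi> (Poly_Mapping.single B b) = Poly_Mapping.single (\<Sum>i\<in>#B. A i) d"
proof (induction B arbitrary: b)
  case empty
  show ?case using twisted_autD(4)[OF \<psi>] by auto
next
  case (add i B)
  obtain d where
    "\<psi> (Poly_Mapping.single B (b / cocycle q {#i#} B)) = Poly_Mapping.single (\<Sum>i\<in>#B. A i) d"
    using add by blast
  then have "\<psi> (Poly_Mapping.single (add_mset i B) b)
      = Poly_Mapping.single (A i + (\<Sum>i\<in>#B. A i)) (cocycle q (A i) (\<Sum>i\<in>#B. A i) * c i * d)"
    by (subst single_add_mset_eq_star[OF q, of i B b], simp only: twisted_autD(3)[OF \<psi>] var)
      (simp only: star_single)
  then show ?case by auto
qed

text \<open>The automorphism and its inverse both send variables to monomials. Let \<open>\<psi>(X\<^sub>i)\<close> have exponent \<open>A i\<close>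
and let \<open>\<psi>\<^sup>-\<^sup>1(X\<^sub>j)\<close> have exponent \<open>B\<close>. Then the \<open>A i\<close> with \<open>i\<close> in \<open>B\<close> add up to \<open>{#j#}\<close>, and none of
them is empty, so \<open>A b = {#j#}\<close> for some \<open>b\<close>. By counting, \<open>A\<close> is then a permutation of
the variables.\<close>

lemma twisted_aut_permutes_vars:
  fixes q :: "'n::{finite,linorder} \<Rightarrow> 'n \<Rightarrow> 'f::field"
  assumes q: "mult_antisymmetric q" "nondegenerate q" "CARD('n) \<ge> 2"
    and \<psi>: "twisted_aut q \<psi>"
  obtains \<sigma> c where "bij \<sigma>" "\<And>i. c i \<noteq> 0" "\<And>i. \<psi> (var i) = Poly_Mapping.single {#\<sigma> i#} (c i)"
proof -
  have "\<forall>i. \<exists>A c. c \<noteq> 0 \<and> \<psi> (var i) = Poly_Mapping.single A c"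
    using normal_element_imp_monomial[OF q twisted_aut_var_normal[OF q(1) \<psi>]] by metis
  then obtain A c where c: "\<And>i. c i \<noteq> 0" and var: "\<And>i. \<psi> (var i) = Poly_Mapping.single (A i) (c i)"
    by metis
  have A_nonempty: "A i \<noteq> {#}" for i
  proof
    assume "A i = {#}"
    then have "\<psi> (var i) = \<psi> (Poly_Mapping.single {#} (c i))"
      by (simp add: var twisted_autD(4)[OF \<psi>])
    then have "var i = Poly_Mapping.single {#} (c i)"
      using twisted_autD(5)[OF \<psi>] by (rule injD[rotated])
    then have "Poly_Mapping.keys (var i :: 'n multiset \<Rightarrow>\<^sub>0 'f) = Poly_Mapping.keys (Poly_Mapping.single {#} (c i))"
      by (rule arg_cong)
    then show False using c by simp
  qed
  have "\<exists>b. A b = {#j#}" for j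
  proof -
    obtain B s where "inv_into UNIV \<psi> (var j) = Poly_Mapping.single B s"
      using normal_element_imp_monomial[OF q twisted_aut_var_normal[OF q(1) twisted_aut_inv[OF \<psi>]]] by metis
    then have "\<psi> (Poly_Mapping.single B s) = var j"
      using twisted_autD(6)[OF \<psi>] by (metis surj_f_inv_f)
    moreover obtain d where "\<psi> (Poly_Mapping.single B s) = Poly_Mapping.single (\<Sum>i\<in>#B. A i) d"
      using twisted_aut_monomial[OF q(1) \<psi> var] by blast
    ultimately have "Poly_Mapping.keys (var j :: 'n multiset \<Rightarrow>\<^sub>0 'f) = Poly_Mapping.keys (Poly_Mapping.single (\<Sum>i\<in>#B. A i) d)"
      by simp
    then have sum: "(\<Sum>i\<in>#B. A i) = {#j#}" by (auto split: if_splits)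
    then have "B \<noteq> {#}" by auto
    then obtain b B' where "B = add_mset b B'" by (metis multiset_cases)
    with sum have "A b + (\<Sum>i\<in>#B'. A i) = {#j#}" by simp
    then have "A b = {#j#}" using A_nonempty[of b] by (auto simp: union_is_single)
    then show ?thesis ..
  qed
  then obtain \<tau> where \<tau>: "\<And>j. A (\<tau> j) = {#j#}" by metis
  then have "inj \<tau>" by (metis injI add_mset_eq_single)
  then have "bij \<tau>" by (simp add: bij_def finite_UNIV_inj_surj)
  then have "A i = {#inv_into UNIV \<tau> i#}" for i
    using \<tau>[of "inv_into UNIV \<tau> i"] by (simp add: bij_is_surj surj_f_inv_f)
  with \<open>bij \<tau>\<close> var c show ?thesis
    by (intro that[of "inv_into UNIV \<tau>" c]) (auto simp: bij_imp_bij_inv)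
qed

lemma cocycle_var_commute:
  assumes "mult_antisymmetric q"
  shows "cocycle q {#i#} {#j#} = q i j * cocycle q {#j#} {#i#}"
  using bichar_lower_commute[OF assms, of "unit_vec i" "unit_vec j"]
  by (simp add: cocycle_def bichar_unit_unit)

text \<open>The vector with all entries \<open>1\<close> is fixed by \<open>\<sigma>\<close>, so \<open>unit_vec i\<close> and \<open>unit_vec (\<sigma> i)\<close> pair equally
with it, and it is orthogonal to their difference. If \<open>\<sigma> i \<noteq> i\<close>, this
difference is independent of it, since it takes the values \<open>1\<close> and \<open>-1\<close>.\<close>

lemma symmetry_trivial:
  fixes q :: "'n::finite \<Rightarrow> 'n \<Rightarrow> 'f::field"
  assumes q: "mult_antisymmetric q" "nondegenerate q"
    and \<sigma>: "bij \<sigma>" "\<And>i j. q (\<sigma> i) (\<sigma> j) = q i j"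
  shows "\<sigma> i = i"
proof (rule ccontr)
  assume ne: "\<sigma> i \<noteq> i"
  note nonzero = mult_antisymmetricD(1)[OF q(1)]
  let ?one = "\<lambda>_. 1 :: int"
  have one: "bichar q ?one (unit_vec j) = (\<Prod>k\<in>UNIV. q k j)" for j
    by (simp add: bichar_unit_right)
  have "(\<Prod>k\<in>UNIV. q k (\<sigma> i)) = (\<Prod>k\<in>UNIV. q (\<sigma> k) (\<sigma> i))"
    by (rule prod.reindex_bij_betw[OF \<sigma>(1), symmetric])
  then have eq: "bichar q ?one (unit_vec (\<sigma> i)) = bichar q ?one (unit_vec i)"
    by (simp add: one \<sigma>(2))
  have "bichar q ?one (\<lambda>k. unit_vec i k + (-1) * unit_vec (\<sigma> i) k)
      = bichar q ?one (unit_vec i) * bichar q ?one (unit_vec (\<sigma> i)) powi (-1)"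
    by (simp only: bichar_add_right[OF nonzero] bichar_scale_right)
  also have "\<dots> = 1" using nonzero by (simp add: eq bichar_nonzero)
  finally obtain x y where xy: "x \<noteq> 0 \<or> y \<noteq> 0"
    "\<forall>k. x * 1 + y * (unit_vec i k + (-1) * unit_vec (\<sigma> i) k) = 0"
    using q(2) unfolding nondegenerate_def by blast
  from xy(2)[rule_format, of i] xy(2)[rule_format, of "\<sigma> i"] ne
  have "x + y = 0" "x - y = 0" by (simp_all add: unit_vec_def)
  with xy(1) show False by presburger
qed

text \<open>Applying \<open>\<psi>\<close> to \<open>X\<^sub>i X\<^sub>j = q i j X\<^sub>j X\<^sub>i\<close> shows that the permutation of the variables preserves \<open>q\<close>.\<close>

lemma twisted_aut_var:
  fixes q :: "'n::{finite,linorder} \<Rightarrow> 'n \<Rightarrow> 'f::field"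
  assumes q: "mult_antisymmetric q" "nondegenerate q" "CARD('n) \<ge> 2"
    and \<psi>: "twisted_aut q \<psi>"
  obtains t where "\<And>i. t i \<noteq> 0" "\<And>i. \<psi> (var i) = Poly_Mapping.single {#i#} (t i)"
proof -
  obtain \<sigma> c where \<sigma>: "bij \<sigma>" and c: "\<And>i. c i \<noteq> 0"
    and var: "\<And>i. \<psi> (var i) = Poly_Mapping.single {#\<sigma> i#} (c i)"
    by (rule twisted_aut_permutes_vars[OF q \<psi>]) blast
  have "q (\<sigma> i) (\<sigma> j) = q i j" for i j
  proof -
    have "star q (var i) (var j) = star q (Poly_Mapping.single {#} (q i j)) (star q (var j) (var i))"
      by (simp add: star_single cocycle_var_commute[OF q(1), of i j] add_mset_commute)
    then have "\<psi> (star q (var i) (var j)) = \<psi> (star q (Poly_Mapping.single {#} (q i j)) (star q (var j) (var i)))"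
      by (rule arg_cong)
    then have "star q (\<psi> (var i)) (\<psi> (var j))
        = star q (Poly_Mapping.single {#} (q i j)) (star q (\<psi> (var j)) (\<psi> (var i)))"
      by (simp only: twisted_autD(3,4)[OF \<psi>])
    then have "Poly_Mapping.single ({#\<sigma> i#} + {#\<sigma> j#}) (cocycle q {#\<sigma> i#} {#\<sigma> j#} * c i * c j)
        = Poly_Mapping.single ({#\<sigma> i#} + {#\<sigma> j#}) (q i j * (cocycle q {#\<sigma> j#} {#\<sigma> i#} * c j * c i))"
      by (simp only: var star_single add_0_left cocycle_empty mult_1_left add.commute[of "{#\<sigma> j#}"])
    then have "cocycle q {#\<sigma> i#} {#\<sigma> j#} * c i * c j = q i j * (cocycle q {#\<sigma> j#} {#\<sigma> i#} * c j * c i)"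
      by (rule injD[OF inj_single])
    then have "(q (\<sigma> i) (\<sigma> j) * cocycle q {#\<sigma> j#} {#\<sigma> i#}) * (c i * c j) = (q i j * cocycle q {#\<sigma> j#} {#\<sigma> i#}) * (c i * c j)"
      unfolding cocycle_var_commute[OF q(1), of "\<sigma> i" "\<sigma> j"] by (simp only: mult_ac)
    then show ?thesis using c cocycle_nonzero[OF q(1)] by simp
  qed
  from symmetry_trivial[OF q(1,2) \<sigma> this] var c show ?thesis
    by (intro that[of c]) auto
qed

definition scale_vars :: "('n \<Rightarrow> 'f::field) \<Rightarrow> ('n multiset \<Rightarrow>\<^sub>0 'f) \<Rightarrow> ('n multiset \<Rightarrow>\<^sub>0 'f)" where
  "scale_vars t = lin_ext (\<lambda>A a. Poly_Mapping.single A ((\<Prod>i\<in>#A. t i) * a))"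

lemma scale_vars_single:
  "scale_vars t (Poly_Mapping.single A a) = Poly_Mapping.single A ((\<Prod>i\<in>#A. t i) * a)"
  by (simp add: scale_vars_def lin_ext_single)

lemma scale_vars_add: "scale_vars t (f + g) = scale_vars t f + scale_vars t g"
  unfolding scale_vars_def by (rule lin_ext_add) (simp_all add: distrib_left single_add)

lemma scale_vars_mult: "scale_vars (\<lambda>i. s i * t i) f = scale_vars s (scale_vars t f)"
  by (rule additive_eqI) (simp_all add: scale_vars_single scale_vars_add prod_mset.distrib mult.assoc)

lemma scale_vars_one: "scale_vars (\<lambda>_. 1) f = f"
  by (rule additive_eqI) (simp_all add: scale_vars_single scale_vars_add)

lemma scale_vars_star: "scale_vars t (star q f g) = star q (scale_vars t f) (scale_vars t g)"
proof (induction f rule: poly_mapping_add_induct)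
  case (single A a)
  show ?case
    by (induction g rule: poly_mapping_add_induct)
      (simp_all add: star_single scale_vars_single star_add_right scale_vars_add mult_ac)
qed (simp add: star_add_left scale_vars_add)

lemma twisted_aut_scale_vars:
  assumes "\<And>i. t i \<noteq> 0"
  shows "twisted_aut q (scale_vars t)"
proof -
  have "scale_vars t (scale_vars (\<lambda>i. inverse (t i)) f) = f"
    "scale_vars (\<lambda>i. inverse (t i)) (scale_vars t f) = f" for f
    using assms by (simp_all add: scale_vars_one flip: scale_vars_mult)
  then have "bij (scale_vars t)" by (metis bijI')
  then show ?thesis
    by (simp add: twisted_aut_def scale_vars_add scale_vars_star scale_vars_single)
qed

lemma twisted_aut_eq_scale_vars:
  assumes q: "mult_antisymmetric q" and \<psi>: "twisted_aut q \<psi>"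
    and var: "\<And>i. \<psi> (var i) = Poly_Mapping.single {#i#} (t i)"
  shows "\<psi> f = scale_vars t f"
proof (rule additive_eqI[of \<psi>])
  show "\<psi> (Poly_Mapping.single A a) = scale_vars t (Poly_Mapping.single A a)" for A a
  proof (induction A arbitrary: a)
    case empty
    show ?case by (simp add: twisted_autD(4)[OF \<psi>] scale_vars_single)
  next
    case (add i A)
    have "scale_vars t (var i) = Poly_Mapping.single {#i#} (t i)"
      by (simp add: scale_vars_single)
    then show ?case
      by (subst (1 2) single_add_mset_eq_star[OF q, of i A a])
        (simp only: twisted_autD(3)[OF \<psi>] scale_vars_star var add.IH)
  qed
qed (simp_all add: twisted_autD(2)[OF \<psi>] scale_vars_add)

section \<open>Normal forms in the quantum affine space\<close>

lemma weight_unit_vec: "weight unit_vec w = mexp (mset w)"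
  by (induction w) simp_all

text \<open>The expansion of an element of the free algebra in ordered monomials of the quantum affine space.\<close>

definition normal_form ::
    "('n::{finite,linorder} \<Rightarrow> 'n \<Rightarrow> 'f::field) \<Rightarrow> ('n list \<Rightarrow>\<^sub>0 'f) \<Rightarrow> ('n multiset \<Rightarrow>\<^sub>0 'f)" where
  "normal_form q = lin_ext (\<lambda>w c. Poly_Mapping.single (mset w) (c * word_coeff (lower q) unit_vec w))"

lemma normal_form_single:
  "normal_form q (Poly_Mapping.single w c)
     = Poly_Mapping.single (mset w) (c * word_coeff (lower q) unit_vec w)"
  by (simp add: normal_form_def lin_ext_single)

lemma normal_form_add: "normal_form q (x + y) = normal_form q x + normal_form q y"
  unfolding normal_form_def by (rule lin_ext_add) (simp_all add: distrib_right single_add)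

lemma normal_form_zero [simp]: "normal_form q 0 = 0"
  by (simp add: normal_form_def)

lemma normal_form_minus: "normal_form q (x - y) = normal_form q x - normal_form q y"
  by (metis normal_form_add add_diff_cancel_right' diff_add_cancel)

lemma normal_form_mult:
  assumes "mult_antisymmetric q"
  shows "normal_form q (x * y) = star q (normal_form q x) (normal_form q y)"
proof (induction x rule: poly_mapping_add_induct)
  case (single v c)
  show ?case
  proof (induction y rule: poly_mapping_add_induct)
    case (single w d)
    show ?case
      using assms by (simp add: word_mult_single normal_form_single star_single cocycle_def
          word_coeff_append lower_nonzero weight_unit_vec mult_ac)
  qed (simp add: distrib_left normal_form_add star_add_right)
qed (simp add: distrib_right normal_form_add star_add_left)

abbreviation affine_class ::
    "('n::{finite,linorder} \<Rightarrow> 'n \<Rightarrow> 'f::field) \<Rightarrow> ('n list \<Rightarrow>\<^sub>0 'f) \<Rightarrow> ('n list \<Rightarrow>\<^sub>0 'f) set" where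
  "affine_class q \<equiv> residue_class (affine_relations q)"

lemma normal_form_relation:
  assumes q: "mult_antisymmetric q" and r: "r \<in> affine_relations q"
  shows "normal_form q r = 0"
proof -
  obtain i j where "i < j" and r: "r = gen i * gen j - const (q i j) * gen j * gen i"
    using r by (auto simp: affine_relations_def)
  then show ?thesis
    using mult_antisymmetricD(3)[OF q, of i j]
    by (auto simp: gen_def const_def word_mult_single normal_form_minus normal_form_single
        bichar_unit_unit lower_def add_mset_commute)
qed

lemma normal_form_cong:
  assumes q: "mult_antisymmetric q" and "affine_class q x = affine_class q y"
  shows "normal_form q x = normal_form q y"
proof -
  have "Idl\<^bsub>free_algebra\<^esub> (affine_relations q) \<subseteq> {x. normal_form q x = 0}"
    by (rule genideal_free_algebra_subset)
      (auto simp: normal_form_relation[OF q] normal_form_add normal_form_mult[OF q])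
  with assms(2) have "normal_form q (x - y) = 0"
    unfolding residue_class_eq_iff by blast
  then show ?thesis by (simp add: normal_form_minus)
qed

lemma residue_class_mult_cong:
  assumes "residue_class rels x = residue_class rels y"
  shows "residue_class rels (a * x * b) = residue_class rels (a * y * b)"
  using assms by (simp flip: residue_class_mult)

lemma residue_class_add_cong:
  assumes "residue_class rels x = residue_class rels y" "residue_class rels x' = residue_class rels y'"
  shows "residue_class rels (x + x') = residue_class rels (y + y')"
  using assms by (simp flip: residue_class_add)

text \<open>The relations are stated for ascending pairs of letters; a descending pair is sorted by reading
them backwards and dividing by \<open>q j i\<close>, which is multiplication by \<open>q i j\<close>.\<close>

lemma affine_class_swap:
  assumes q: "mult_antisymmetric q" and "j < i"
  shows "affine_class q (Poly_Mapping.single (i # j # w) c)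
    = affine_class q (Poly_Mapping.single (j # i # w) (c * q i j))"
proof -
  have "gen j * gen i - const (q j i) * gen i * gen j \<in> affine_relations q"
    using \<open>j < i\<close> by (auto simp: affine_relations_def)
  then have "affine_class q (gen j * gen i) = affine_class q (const (q j i) * gen i * gen j)"
    by (rule residue_class_relation)
  then have "affine_class q (Poly_Mapping.single [] (c * q i j) * (gen j * gen i) * Poly_Mapping.single w 1)
      = affine_class q (Poly_Mapping.single [] (c * q i j) * (const (q j i) * gen i * gen j) * Poly_Mapping.single w 1)"
    by (rule residue_class_mult_cong)
  moreover have "c * q i j * q j i = c"
    using mult_antisymmetricD(3)[OF q, of i j] by (simp add: mult.assoc)
  ultimately show ?thesis
    by (simp add: gen_def const_def word_mult_single)
qed

lemma affine_class_insort:
  assumes q: "mult_antisymmetric q"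
  shows "\<exists>d. affine_class q (Poly_Mapping.single (i # w) c) = affine_class q (Poly_Mapping.single (insort i w) d)"
proof (induction w arbitrary: c)
  case (Cons j w)
  show ?case
  proof (cases "i \<le> j")
    case False
    obtain d where d: "affine_class q (Poly_Mapping.single (i # w) (c * q i j))
        = affine_class q (Poly_Mapping.single (insort i w) d)"
      using Cons by blast
    have "affine_class q (Poly_Mapping.single (i # j # w) c)
        = affine_class q (Poly_Mapping.single (j # i # w) (c * q i j))"
      using False by (intro affine_class_swap[OF q]) simp
    also have "\<dots> = affine_class q (Poly_Mapping.single (j # insort i w) d)"
      using residue_class_mult_cong[OF d, of "Poly_Mapping.single [j] 1" 1]
      by (simp add: word_mult_single)
    finally show ?thesis using False by auto
  qed auto
qed auto

text \<open>Only the existence of the scalar matters here; its value is determined afterwards by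
comparing normal forms.\<close>

lemma affine_class_sort:
  assumes q: "mult_antisymmetric q"
  shows "\<exists>d. affine_class q (Poly_Mapping.single w c) = affine_class q (Poly_Mapping.single (sort w) d)"
proof (induction w arbitrary: c)
  case (Cons i w)
  obtain d where d: "affine_class q (Poly_Mapping.single w c) = affine_class q (Poly_Mapping.single (sort w) d)"
    using Cons by blast
  obtain e where "affine_class q (Poly_Mapping.single (i # sort w) d)
      = affine_class q (Poly_Mapping.single (insort i (sort w)) e)"
    using affine_class_insort[OF q] by blast
  then have "affine_class q (Poly_Mapping.single (i # w) c) = affine_class q (Poly_Mapping.single (sort (i # w)) e)"
    using residue_class_mult_cong[OF d, of "Poly_Mapping.single [i] 1" 1]
    by (simp add: word_mult_single)
  then show ?case ..
qed auto

text \<open>The coefficient divides by the straightening factor of the sorted word, so that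
\<open>normal_form\<close> is a left inverse whatever that factor is.\<close>

definition standard_rep ::
    "('n::{finite,linorder} \<Rightarrow> 'n \<Rightarrow> 'f::field) \<Rightarrow> ('n multiset \<Rightarrow>\<^sub>0 'f) \<Rightarrow> ('n list \<Rightarrow>\<^sub>0 'f)" where
  "standard_rep q = lin_ext (\<lambda>A c. Poly_Mapping.single (sorted_list_of_multiset A)
     (c / word_coeff (lower q) unit_vec (sorted_list_of_multiset A)))"

lemma standard_rep_single:
  "standard_rep q (Poly_Mapping.single A c) = Poly_Mapping.single (sorted_list_of_multiset A)
     (c / word_coeff (lower q) unit_vec (sorted_list_of_multiset A))"
  by (simp add: standard_rep_def lin_ext_single)

lemma standard_rep_add: "standard_rep q (f + g) = standard_rep q f + standard_rep q g"
  unfolding standard_rep_def by (rule lin_ext_add) (simp_all add: add_divide_distrib single_add)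

lemma normal_form_standard_rep:
  assumes "mult_antisymmetric q"
  shows "normal_form q (standard_rep q f) = f"
  by (rule additive_eqI[where f = "\<lambda>f. normal_form q (standard_rep q f)" and g = "\<lambda>f. f"])
    (simp_all add: normal_form_add standard_rep_add standard_rep_single normal_form_single
      word_coeff_nonzero lower_nonzero assms)

lemma affine_class_standard_rep:
  assumes q: "mult_antisymmetric q"
  shows "affine_class q x = affine_class q (standard_rep q (normal_form q x))"
proof (induction x rule: poly_mapping_add_induct)
  case (single w c)
  let ?wc = "word_coeff (lower q) unit_vec"
  obtain d where d: "affine_class q (Poly_Mapping.single w c) = affine_class q (Poly_Mapping.single (sort w) d)"
    using affine_class_sort[OF q] by blast
  have "Poly_Mapping.single (mset w) (c * ?wc w) = Poly_Mapping.single (mset w) (d * ?wc (sort w))"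
    using normal_form_cong[OF q d] by (simp add: normal_form_single)
  then have "c * ?wc w = d * ?wc (sort w)" by (rule injD[OF inj_single])
  then have "d = c * ?wc w / ?wc (sort w)"
    by (simp add: word_coeff_nonzero lower_nonzero q)
  with d show ?case
    by (simp add: normal_form_single standard_rep_single)
next
  case (add x y)
  then show ?case
    unfolding normal_form_add standard_rep_add by (rule residue_class_add_cong)
qed

definition of_normal_form ::
    "('n::{finite,linorder} \<Rightarrow> 'n \<Rightarrow> 'f::field) \<Rightarrow> ('n multiset \<Rightarrow>\<^sub>0 'f) \<Rightarrow> ('n list \<Rightarrow>\<^sub>0 'f) set" where
  "of_normal_form q f = affine_class q (standard_rep q f)"

lemma of_normal_form_eq:
  assumes "mult_antisymmetric q" "normal_form q x = f"
  shows "of_normal_form q f = affine_class q x"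
  using affine_class_standard_rep[OF assms(1), of x] assms(2) by (simp add: of_normal_form_def)

text \<open>The ordered monomials form a basis of the quantum affine space: they span because
words can be sorted, and they are independent because \<open>normal_form\<close> respects the relations.\<close>

lemma bij_betw_of_normal_form:
  assumes "mult_antisymmetric q"
  shows "bij_betw (of_normal_form q) UNIV (carrier (quantum_affine_space q))"
proof (rule bij_betw_imageI)
  show "inj (of_normal_form q)"
    by (rule injI) (metis assms normal_form_cong normal_form_standard_rep of_normal_form_def)
  show "range (of_normal_form q) = carrier (quantum_affine_space q)"
    unfolding quantum_affine_space_def carrier_presented_algebra
    using of_normal_form_eq[OF assms] by (auto simp: of_normal_form_def image_iff)
qed

text \<open>Together with bijectivity: the quantum affine space is the algebra of twisted polynomials.\<close>

lemma of_normal_form_hom: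
  assumes "mult_antisymmetric q"
  shows "of_normal_form q (star q f g)
      = of_normal_form q f \<otimes>\<^bsub>quantum_affine_space q\<^esub> of_normal_form q g"
    and "of_normal_form q (f + g)
      = of_normal_form q f \<oplus>\<^bsub>quantum_affine_space q\<^esub> of_normal_form q g"
    and "of_normal_form q (Poly_Mapping.single {#} c) = affine_scalar q c"
    and "of_normal_form q 1 = \<one>\<^bsub>quantum_affine_space q\<^esub>"
    and "of_normal_form q (var i) = affine_gen q i"
proof -
  have "of_normal_form q (star q f g) = affine_class q (standard_rep q f * standard_rep q g)"
    by (rule of_normal_form_eq) (simp_all add: assms normal_form_mult normal_form_standard_rep)
  then show "of_normal_form q (star q f g)
      = of_normal_form q f \<otimes>\<^bsub>quantum_affine_space q\<^esub> of_normal_form q g"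
    by (simp add: of_normal_form_def quantum_affine_space_def residue_class_mult)
  show "of_normal_form q (f + g)
      = of_normal_form q f \<oplus>\<^bsub>quantum_affine_space q\<^esub> of_normal_form q g"
    by (simp add: of_normal_form_def quantum_affine_space_def residue_class_add standard_rep_add)
  show *: "of_normal_form q (Poly_Mapping.single {#} c) = affine_scalar q c" for c
    unfolding affine_scalar_def
    by (rule of_normal_form_eq) (simp_all add: assms const_def normal_form_single)
  show "of_normal_form q 1 = \<one>\<^bsub>quantum_affine_space q\<^esub>"
    using *[of 1]
    by (simp add: affine_scalar_def quantum_affine_space_def residue_class_one const_def
        one_eq_single_Nil)
  show "of_normal_form q (var i) = affine_gen q i"
    unfolding affine_gen_def
    by (rule of_normal_form_eq) (simp_all add: assms gen_def normal_form_single)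
qed

section \<open>Algebra automorphisms of the quantum affine space\<close>

text \<open>The restriction to the carrier makes the result extensional, as \<open>algebra_auts\<close> requires.\<close>

definition transport ::
    "('n::{finite,linorder} \<Rightarrow> 'n \<Rightarrow> 'f::field) \<Rightarrow> (('n multiset \<Rightarrow>\<^sub>0 'f) \<Rightarrow> ('n multiset \<Rightarrow>\<^sub>0 'f))
      \<Rightarrow> ('n list \<Rightarrow>\<^sub>0 'f) set \<Rightarrow> ('n list \<Rightarrow>\<^sub>0 'f) set" where
  "transport q \<psi> = (\<lambda>a\<in>carrier (quantum_affine_space q).
     of_normal_form q (\<psi> (inv_into UNIV (of_normal_form q) a)))"

lemma of_normal_form_in_carrier:
  "mult_antisymmetric q \<Longrightarrow> of_normal_form q f \<in> carrier (quantum_affine_space q)"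
  using bij_betw_of_normal_form by (auto simp: bij_betw_def)

lemma obtain_normal_form:
  assumes "mult_antisymmetric q" "a \<in> carrier (quantum_affine_space q)"
  obtains f where "a = of_normal_form q f"
  using assms(2) bij_betw_imp_surj_on[OF bij_betw_of_normal_form[OF assms(1)]] that by blast

lemma of_normal_form_inject:
  "mult_antisymmetric q \<Longrightarrow> of_normal_form q f = of_normal_form q g \<longleftrightarrow> f = g"
  using bij_betw_imp_inj_on[OF bij_betw_of_normal_form] by (rule inj_eq)

lemma transport_of_normal_form:
  assumes "mult_antisymmetric q"
  shows "transport q \<psi> (of_normal_form q f) = of_normal_form q (\<psi> f)"
  using bij_betw_of_normal_form[OF assms] of_normal_form_in_carrier[OF assms]
  by (simp add: transport_def bij_betw_def)

lemma transport_in_algebra_auts: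
  assumes q: "mult_antisymmetric q" and \<psi>: "twisted_aut q \<psi>"
  shows "transport q \<psi> \<in> algebra_auts (affine_scalar q) (quantum_affine_space q)"
proof -
  let ?R = "quantum_affine_space q"
  note T = transport_of_normal_form[OF q] and hom = of_normal_form_hom[OF q]
  note in_carrier = of_normal_form_in_carrier[OF q]
  have "bij_betw (of_normal_form q \<circ> (\<psi> \<circ> inv_into UNIV (of_normal_form q))) (carrier ?R) (carrier ?R)"
    using bij_betw_of_normal_form[OF q] twisted_autD(1)[OF \<psi>] bij_betw_inv_into
    by (metis bij_betw_trans)
  then have "transport q \<psi> \<in> Bij (carrier ?R)"
    by (auto simp: Bij_def transport_def intro: bij_betw_cong[THEN iffD1, rotated])
  moreover have "transport q \<psi> \<in> ring_hom ?R ?R"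
  proof (rule ring_hom_memI)
    fix a b assume "a \<in> carrier ?R" "b \<in> carrier ?R"
    then obtain f g where fg: "a = of_normal_form q f" "b = of_normal_form q g"
      using obtain_normal_form[OF q] by metis
    show "transport q \<psi> a \<in> carrier ?R" by (simp add: fg T in_carrier)
    show "transport q \<psi> (a \<otimes>\<^bsub>?R\<^esub> b) = transport q \<psi> a \<otimes>\<^bsub>?R\<^esub> transport q \<psi> b"
      by (simp add: fg T twisted_autD(3)[OF \<psi>] flip: hom(1))
    show "transport q \<psi> (a \<oplus>\<^bsub>?R\<^esub> b) = transport q \<psi> a \<oplus>\<^bsub>?R\<^esub> transport q \<psi> b"
      by (simp add: fg T twisted_autD(2)[OF \<psi>] flip: hom(2))
  next
    show "transport q \<psi> \<one>\<^bsub>?R\<^esub> = \<one>\<^bsub>?R\<^esub>"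
      by (simp add: T twisted_autD(8)[OF \<psi>] flip: hom(4))
  qed
  moreover have "transport q \<psi> (affine_scalar q c \<otimes>\<^bsub>?R\<^esub> a) = affine_scalar q c \<otimes>\<^bsub>?R\<^esub> transport q \<psi> a"
    if "a \<in> carrier ?R" for c a
  proof -
    obtain f where "a = of_normal_form q f" using obtain_normal_form[OF q \<open>a \<in> carrier ?R\<close>] .
    then show ?thesis
      by (simp add: T twisted_autD(3,4)[OF \<psi>] flip: hom(1,3))
  qed
  ultimately show ?thesis by (simp add: algebra_auts_def)
qed

text \<open>An algebra automorphism fixes the scalars because it is linear and unital.\<close>

lemma algebra_aut_eq_transport:
  assumes q: "mult_antisymmetric q"
    and \<phi>: "\<phi> \<in> algebra_auts (affine_scalar q) (quantum_affine_space q)"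
  obtains \<psi> where "twisted_aut q \<psi>" "\<phi> = transport q \<psi>"
proof -
  let ?R = "quantum_affine_space q" and ?F = "of_normal_form q"
  note hom = of_normal_form_hom[OF q] and in_carrier = of_normal_form_in_carrier[OF q]
  have ring_hom: "\<phi> \<in> ring_hom ?R ?R" and Bij: "\<phi> \<in> Bij (carrier ?R)"
    and scalar: "\<And>c a. a \<in> carrier ?R \<Longrightarrow> \<phi> (affine_scalar q c \<otimes>\<^bsub>?R\<^esub> a) = affine_scalar q c \<otimes>\<^bsub>?R\<^esub> \<phi> a"
    using \<phi> by (auto simp: algebra_auts_def)
  define \<psi> where "\<psi> = inv_into UNIV ?F \<circ> (\<phi> \<circ> ?F)"
  have F_\<psi>: "?F (\<psi> f) = \<phi> (?F f)" for f
  proof -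
    have "\<phi> (?F f) \<in> range ?F"
      using bij_betw_of_normal_form[OF q] ring_hom_closed[OF ring_hom in_carrier]
      by (simp add: bij_betw_def)
    then show ?thesis by (simp add: \<psi>_def f_inv_into_f)
  qed
  have \<psi>I: "\<psi> f = g" if "\<phi> (?F f) = ?F g" for f g
    using that F_\<psi> of_normal_form_inject[OF q] by metis
  have "bij \<psi>"
    unfolding \<psi>_def using bij_betw_of_normal_form[OF q] Bij bij_betw_inv_into
    by (metis Bij_def Int_iff bij_betw_trans mem_Collect_eq)
  moreover have "\<psi> (f + g) = \<psi> f + \<psi> g" for f g
    by (rule \<psi>I) (simp add: hom(2) F_\<psi> ring_hom_add[OF ring_hom in_carrier in_carrier])
  moreover have "\<psi> (star q f g) = star q (\<psi> f) (\<psi> g)" for f g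
    by (rule \<psi>I) (simp add: hom(1) F_\<psi> ring_hom_mult[OF ring_hom in_carrier in_carrier])
  moreover have "\<psi> (Poly_Mapping.single {#} c) = Poly_Mapping.single {#} c" for c
  proof (rule \<psi>I)
    have "star q (Poly_Mapping.single {#} c) 1 = Poly_Mapping.single {#} c"
      using star_single[of q "{#}" c "{#}" 1] by simp
    then have "affine_scalar q c \<otimes>\<^bsub>?R\<^esub> \<one>\<^bsub>?R\<^esub> = affine_scalar q c"
      by (metis hom(1,3,4))
    then show "\<phi> (?F (Poly_Mapping.single {#} c)) = ?F (Poly_Mapping.single {#} c)"
      using scalar[of "\<one>\<^bsub>?R\<^esub>" c] ring_hom_one[OF ring_hom] in_carrier[of 1]
      by (simp add: hom(3,4))
  qed
  ultimately have \<psi>: "twisted_aut q \<psi>" by (simp add: twisted_aut_def)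
  have "\<phi> = transport q \<psi>"
  proof (rule extensionalityI)
    show "\<phi> \<in> extensional (carrier ?R)" using Bij by (simp add: Bij_def)
    show "transport q \<psi> \<in> extensional (carrier ?R)" by (simp add: transport_def)
    fix a assume "a \<in> carrier ?R"
    then obtain f where "a = ?F f" using obtain_normal_form[OF q] by metis
    then show "\<phi> a = transport q \<psi> a" by (simp add: transport_of_normal_form[OF q] F_\<psi>)
  qed
  with \<psi> show ?thesis by (rule that)
qed

theorem theorem5p1:
  fixes q :: "'n::{finite,linorder} \<Rightarrow> 'n \<Rightarrow> 'f::field"
  assumes "CARD('n) \<ge> 2"
    and "mult_antisymmetric q"
    and "has_krull_dim (quantum_torus q) 1"
  shows "\<exists>\<Phi> \<in> iso scaling_group (aut_group q).
           \<forall>t \<in> carrier scaling_group. \<forall>i.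
             \<Phi> t (affine_gen q i)
               = affine_scalar q (t i) \<otimes>\<^bsub>quantum_affine_space q\<^esub> affine_gen q i"
proof -
  note q = assms(2)
  note nondeg = krull_dim_one_imp_nondegenerate[OF assms(2,3)]
  let ?R = "quantum_affine_space q" and ?F = "of_normal_form q"
  let ?A = "algebra_auts (affine_scalar q) ?R"
  define \<Phi> where "\<Phi> t = transport q (scale_vars t)" for t
  note T = transport_of_normal_form[OF q] and hom = of_normal_form_hom[OF q]
  have in_auts: "\<Phi> t \<in> ?A" if "\<And>i. t i \<noteq> 0" for t
    unfolding \<Phi>_def using that by (intro transport_in_algebra_auts[OF q] twisted_aut_scale_vars)
  have gen: "\<Phi> t (affine_gen q i) = affine_scalar q (t i) \<otimes>\<^bsub>?R\<^esub> affine_gen q i" for t i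
  proof -
    have "scale_vars t (var i) = star q (Poly_Mapping.single {#} (t i)) (var i)"
      by (simp add: scale_vars_single star_single)
    then show ?thesis by (simp only: \<Phi>_def T flip: hom(1,3,5))
  qed
  have mult: "\<Phi> (\<lambda>i. s i * t i) = compose (carrier ?R) (\<Phi> s) (\<Phi> t)" for s t
  proof (rule extensionalityI)
    show "\<Phi> (\<lambda>i. s i * t i) \<in> extensional (carrier ?R)" by (simp add: \<Phi>_def transport_def)
    show "compose (carrier ?R) (\<Phi> s) (\<Phi> t) \<in> extensional (carrier ?R)" by (rule compose_extensional)
    fix a assume a: "a \<in> carrier ?R"
    then obtain f where "a = ?F f" using obtain_normal_form[OF q] by metis
    with a show "\<Phi> (\<lambda>i. s i * t i) a = compose (carrier ?R) (\<Phi> s) (\<Phi> t) a"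
      by (simp add: \<Phi>_def T scale_vars_mult compose_eq)
  qed
  have inj: "s = t" if "\<Phi> s = \<Phi> t" for s t
  proof
    fix i
    have "?F (scale_vars s (var i)) = ?F (scale_vars t (var i))"
      using that by (simp add: \<Phi>_def flip: T)
    then have "Poly_Mapping.single {#i#} (s i) = Poly_Mapping.single {#i#} (t i)"
      by (simp add: of_normal_form_inject[OF q] scale_vars_single)
    then show "s i = t i" by (rule injD[OF inj_single])
  qed
  have surj: "\<exists>t. (\<forall>i. t i \<noteq> 0) \<and> \<phi> = \<Phi> t" if \<phi>: "\<phi> \<in> ?A" for \<phi>
  proof -
    obtain \<psi> where \<psi>: "twisted_aut q \<psi>" "\<phi> = transport q \<psi>"
      using algebra_aut_eq_transport[OF q \<phi>] .
    obtain t where t: "\<And>i. t i \<noteq> 0" "\<And>i. \<psi> (var i) = Poly_Mapping.single {#i#} (t i)"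
      by (rule twisted_aut_var[OF q nondeg assms(1) \<psi>(1)]) blast
    have "\<psi> = scale_vars t"
      using twisted_aut_eq_scale_vars[OF q \<psi>(1) t(2)] by blast
    with \<psi>(2) t(1) show ?thesis by (auto simp: \<Phi>_def)
  qed
  have "\<Phi> \<in> iso scaling_group (aut_group q)"
  proof (rule isoI)
    show "\<Phi> \<in> hom scaling_group (aut_group q)"
    proof (rule homI)
      fix s t :: "'n \<Rightarrow> 'f"
      assume st: "s \<in> carrier scaling_group" "t \<in> carrier scaling_group"
      then have "\<Phi> s \<in> ?A" "\<Phi> t \<in> ?A" by (auto simp: scaling_group_def intro!: in_auts)
      then show "\<Phi> s \<in> carrier (aut_group q)"
        and "\<Phi> (s \<otimes>\<^bsub>scaling_group\<^esub> t) = \<Phi> s \<otimes>\<^bsub>aut_group q\<^esub> \<Phi> t"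
        by (simp_all add: aut_group_def scaling_group_def BijGroup_def algebra_auts_def mult)
    qed
    show "bij_betw \<Phi> (carrier scaling_group) (carrier (aut_group q))"
    proof (rule bij_betw_imageI)
      show "inj_on \<Phi> (carrier scaling_group)" using inj by (auto intro: inj_onI)
      show "\<Phi> ` carrier scaling_group = carrier (aut_group q)"
        using in_auts surj by (auto simp: aut_group_def scaling_group_def image_iff)
    qed
  qed
  with gen show ?thesis by blast
qed

end
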